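(* Let $n\in\mathbb N$. Let $\lambda^\circ=\mathrm{diag}(\lambda_1^\circ,\dots,\lambda_n^\circ)$ (diagonal $(n\times n)$-matrix), $f^\circ$ ($(n\times n)$-matrix) and $g^\circ$ ($n$-vector) have as entries random fields on $\mathbb R^2$, and let $u_0^\circ$ ($n$-vector) have as entries random fields on $\mathbb R$, all with almost surely continuously differentiable paths. Assume that $\lambda^\circ$ satisfies: (AL) for every compact subset $K\subset\mathbb R$, every compact time interval $I$ and almost all $\omega\in\Omega$ there is $\ell(\omega)>0$ such that, for all $i=1,\dots,n$, $|\lambda_i^\circ(x,t,\omega)-\lambda_i^\circ(y,t,\omega)|\le\ell(\omega)|x-y|$ for all $x,y\in K$, $t\in I$; (UB) for every compact time interval $I$ there is a constant $c>0$ such that, for all $i=1,\dots,n$ and almost all $\omega\in\Omega$, $|\lambda_i^\circ(x,t,\omega)|\le c$ for all $x\in\mathbb R$, $t\in I$. Let $u^\circ$ be the (almost surely unique) classical solution with $\mathcal C^1$-paths of $$(\partial_t+\lambda^\circ(x,t)\partial_x)u^\circ=f^\circ(x,t)u^\circ+g^\circ(x,t),\qquad u^\circ(x,0)=u^\circ_0(x),$$ and let $u$, with entries in $\mathcal G_{L^0}(\Omega,\mathbb R^2)$, be the (unique) generalized solution of $$(\partial_t+\lambda(x,t)\partial_x)u=f(x,t)u+g(x,t),\qquad u(x,0)=u_0(x),$$ where $\lambda=\iota(\lambda^\circ)$, $f=\iota(f^\circ)$, $g=\iota(g^\circ)$ have entries in $\mathcal G_{L^0}(\Omega,\mathbb R^2)$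 and $u_0=\iota(u_0^\circ)$ has entries in $\mathcal G_{L^0}(\Omega,\mathbb R)$. Then $u$ is associated with $u^\circ$. More precisely, the representatives $u_\varepsilon$ of $u$ almost surely converge to $u^\circ$ in $\mathcal C(\mathbb R^2)$ (i.e. locally uniformly) as $\varepsilon\to0$.
   Context: $(\Omega,\Sigma,P)$ is a probability space (assumed complete whenever needed). A random field on $\mathbb R^d$ is a map $\mathbb R^d\times\Omega\to\mathbb R$, $(x,\omega)\mapsto A(x,\omega)$, such that $\omega\mapsto A(x,\omega)$ is measurable for every $x$; its paths are the maps $x\mapsto A(x,\omega)$. A family $(r_\varepsilon)_{\varepsilon\in(0,1]}$ of numbers is moderate if $\exists a\ge 0:\ |r_\varepsilon|=O(\varepsilon^{-a})$ as $\varepsilon\to0$, and negligible if $\forall b\ge0:\ |r_\varepsilon|=O(\varepsilon^{b})$ as $\varepsilon\to 0$. A family $(u_\varepsilon)_{\varepsilon\in(0,1]}$ of functions in $\mathcal C^\infty(\mathbb R^d)$ is moderate, written $(u_\varepsilon)\in\mathcal E_M(\mathbb R^d)$ (respectively negligible, written $(u_\varepsilon)\in\mathcal N(\mathbb R^d)$), if for all compact $K\subset\mathbb R^d$ and all $\alpha\in\mathbb N_0^d$ the family $(\sup_{x\in K}|\partial^\alpha u_\varepsilon(x)|)_{\varepsilon}$ is moderate (respectively negligible). $\mathcal E_{M,L^0}(\Omega,\mathbb R^d)$ is the set of families $(u_\varepsilon)_{\varepsilon\in(0,1]}$ of random fields on $\mathbb R^d$ such that: for almost all $\omega$ and all $\varepsilon\in(0,1]$,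 $x\mapsto u_\varepsilon(x,\omega)$ is in $\mathcal C^\infty(\mathbb R^d)$; for all $x,\varepsilon$, $\omega\mapsto u_\varepsilon(x,\omega)$ is measurable; and for almost all $\omega$, $(u_\varepsilon(\cdot,\omega))_\varepsilon\in\mathcal E_M(\mathbb R^d)$. $\mathcal N_{L^0}(\Omega,\mathbb R^d)$ is defined in the same way with $\mathcal N(\mathbb R^d)$ in place of $\mathcal E_M(\mathbb R^d)$. $\mathcal G_{L^0}(\Omega,\mathbb R^d)=\mathcal E_{M,L^0}(\Omega,\mathbb R^d)/\mathcal N_{L^0}(\Omega,\mathbb R^d)$; it is a differential algebra with operations defined on representatives. The restriction of $u\in\mathcal G_{L^0}(\Omega,\mathbb R^2)$ to $t=0$ is the class of $(u_\varepsilon(\cdot,0,\cdot))_\varepsilon$ in $\mathcal G_{L^0}(\Omega,\mathbb R)$. Equations are understood componentwise in $\mathcal G_{L^0}$. Embedding: fix $\rho\in\mathcal S(\mathbb R^d)$ with $\int\rho(x)\,dx=1$ and $\int x^\alpha\rho(x)\,dx=0$ for all $\alpha\in\mathbb N_0^d$, $|\alpha|\ge1$; put $\rho_\varepsilon(x)=\varepsilon^{-d}\rho(x/\varepsilon)$, and let $\chi\in\mathcal D(\mathbb R^d)$ be identically one in a neighborhood of zero. For a random field $X$ on $\mathbb R^d$ with almost surely continuous paths, $\iota(X)\in\mathcal G_{L^0}(\Omega,\mathbb R^d)$ is the class of $\big(X(\cdot,\omega)*(\chi\rho_\varepsilon)\big)_{\varepsilon\in(0,1]}$ (pathwise convolution);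 it is applied entrywise to vectors and matrices. Association (pathwise): $u$ is associated with $u^\circ$ if, for almost all $\omega$, $u_\varepsilon(\cdot,\omega)\to u^\circ(\cdot,\omega)$ in the sense of distributions as $\varepsilon\to0$. Under the stated hypotheses both $u^\circ$ and $u$ exist and are unique (almost surely, respectively in $\mathcal G_{L^0}(\Omega,\mathbb R^2)$). *)

theory Defs
  imports "HOL-Probability.Probability" "HOL-Library.Landau_Symbols"
begin

definition partial_deriv :: "'a::euclidean_space \<Rightarrow> ('a \<Rightarrow> real) \<Rightarrow> 'a \<Rightarrow> real" where
  "partial_deriv b f x = deriv (\<lambda>s. f (x + s *\<^sub>R b)) 0"

definition has_partials :: "('a::euclidean_space \<Rightarrow> real) \<Rightarrow> bool" where
  "has_partials f \<longleftrightarrow> (\<forall>b\<in>Basis. \<forall>x. (\<lambda>s. f (x + s *\<^sub>R b)) field_differentiable at 0)"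

text \<open>A multi-index \<open>\<alpha>\<close> is encoded by a list of basis vectors in which the basis vector \<open>b\<close> occurs
  \<open>\<alpha>\<^sub>b\<close> times; \<open>\<bar>\<alpha>\<bar>\<close> is the length of the list.  For smooth functions the order of the list is
  immaterial because mixed partial derivatives commute.\<close>

definition multi_indices :: "'a::euclidean_space list set" where
  "multi_indices = lists Basis"

definition partial_derivs :: "'a::euclidean_space list \<Rightarrow> ('a \<Rightarrow> real) \<Rightarrow> 'a \<Rightarrow> real" where
  "partial_derivs \<alpha> f = foldr partial_deriv \<alpha> f"

definition monomial :: "'a::euclidean_space list \<Rightarrow> 'a \<Rightarrow> real" where
  "monomial \<alpha> x = (\<Prod>b\<leftarrow>\<alpha>. x \<bullet> b)"

primrec C_k :: "nat \<Rightarrow> ('a::euclidean_space \<Rightarrow> real) \<Rightarrow> bool" where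
  "C_k 0 f \<longleftrightarrow> continuous_on UNIV f"
| "C_k (Suc k) f \<longleftrightarrow>
     continuous_on UNIV f \<and> has_partials f \<and> (\<forall>b\<in>Basis. C_k k (partial_deriv b f))"

definition C_infinity :: "('a::euclidean_space \<Rightarrow> real) \<Rightarrow> bool" where
  "C_infinity f \<longleftrightarrow> (\<forall>k. C_k k f)"

definition test_function :: "('a::euclidean_space \<Rightarrow> real) \<Rightarrow> bool" where
  "test_function \<phi> \<longleftrightarrow> C_infinity \<phi> \<and> compact (closure {x. \<phi> x \<noteq> 0})"

definition schwartz :: "('a::euclidean_space \<Rightarrow> real) \<Rightarrow> bool" where
  "schwartz \<rho> \<longleftrightarrow> C_infinity \<rho> \<and>
     (\<forall>\<alpha>\<in>multi_indices. \<forall>\<beta>\<in>multi_indices.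
        bounded (range (\<lambda>x. monomial \<alpha> x * partial_derivs \<beta> \<rho> x)))"

definition moderate :: "(real \<Rightarrow> real) \<Rightarrow> bool" where
  "moderate r \<longleftrightarrow> (\<exists>a\<ge>0. (\<lambda>\<epsilon>. \<bar>r \<epsilon>\<bar>) \<in> O[at_right 0](\<lambda>\<epsilon>. \<epsilon> powr (-a)))"

definition negligible_family :: "(real \<Rightarrow> real) \<Rightarrow> bool" where
  "negligible_family r \<longleftrightarrow> (\<forall>b\<ge>0. (\<lambda>\<epsilon>. \<bar>r \<epsilon>\<bar>) \<in> O[at_right 0](\<lambda>\<epsilon>. \<epsilon> powr b))"

text \<open>Families indexed by \<open>\<epsilon> \<in> (0,1]\<close> are functions on the reals whose values outside of
  \<open>{0<..1}\<close> are irrelevant.  The compact set is taken nonempty since \<open>Sup {}\<close> is unspecified on the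
  reals.\<close>

definition E_M :: "(real \<Rightarrow> 'a::euclidean_space \<Rightarrow> real) set" where
  "E_M = {u. (\<forall>\<epsilon>\<in>{0<..1}. C_infinity (u \<epsilon>)) \<and>
     (\<forall>K. \<forall>\<alpha>\<in>multi_indices. compact K \<and> K \<noteq> {} \<longrightarrow>
        moderate (\<lambda>\<epsilon>. SUP x\<in>K. \<bar>partial_derivs \<alpha> (u \<epsilon>) x\<bar>))}"

definition N_ideal :: "(real \<Rightarrow> 'a::euclidean_space \<Rightarrow> real) set" where
  "N_ideal = {u. (\<forall>\<epsilon>\<in>{0<..1}. C_infinity (u \<epsilon>)) \<and>
     (\<forall>K. \<forall>\<alpha>\<in>multi_indices. compact K \<and> K \<noteq> {} \<longrightarrow>
        negligible_family (\<lambda>\<epsilon>. SUP x\<in>K. \<bar>partial_derivs \<alpha> (u \<epsilon>) x\<bar>))}"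

definition random_field :: "'w measure \<Rightarrow> ('a::euclidean_space \<Rightarrow> 'w \<Rightarrow> real) \<Rightarrow> bool" where
  "random_field M A \<longleftrightarrow> (\<forall>x. A x \<in> borel_measurable M)"

definition C1_paths :: "'w measure \<Rightarrow> ('a::euclidean_space \<Rightarrow> 'w \<Rightarrow> real) \<Rightarrow> bool" where
  "C1_paths M A \<longleftrightarrow> (AE \<omega> in M. C_k 1 (\<lambda>x. A x \<omega>))"

type_synonym ('a, 'w) field_family = "real \<Rightarrow> 'a \<Rightarrow> 'w \<Rightarrow> real"

definition E_M_L0 :: "'w measure \<Rightarrow> ('a::euclidean_space, 'w) field_family set" where
  "E_M_L0 M = {u. (AE \<omega> in M. \<forall>\<epsilon>\<in>{0<..1}. C_infinity (\<lambda>x. u \<epsilon> x \<omega>)) \<and>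
     (\<forall>\<epsilon>\<in>{0<..1}. random_field M (u \<epsilon>)) \<and>
     (AE \<omega> in M. (\<lambda>\<epsilon> x. u \<epsilon> x \<omega>) \<in> E_M)}"

definition N_L0 :: "'w measure \<Rightarrow> ('a::euclidean_space, 'w) field_family set" where
  "N_L0 M = {u. (AE \<omega> in M. \<forall>\<epsilon>\<in>{0<..1}. C_infinity (\<lambda>x. u \<epsilon> x \<omega>)) \<and>
     (\<forall>\<epsilon>\<in>{0<..1}. random_field M (u \<epsilon>)) \<and>
     (AE \<omega> in M. (\<lambda>\<epsilon> x. u \<epsilon> x \<omega>) \<in> N_ideal)}"

definition gen_rel ::
    "'w measure \<Rightarrow> (('a::euclidean_space, 'w) field_family \<times> ('a, 'w) field_family) set" where
  "gen_rel M = {(u, v). u \<in> E_M_L0 M \<and> v \<in> E_M_L0 M \<and> (\<lambda>\<epsilon> x \<omega>. u \<epsilon> x \<omega> - v \<epsilon> x \<omega>) \<in> N_L0 M}"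

definition G_L0 :: "'w measure \<Rightarrow> ('a::euclidean_space, 'w) field_family set set" where
  "G_L0 M = E_M_L0 M // gen_rel M"

definition gen_class ::
    "'w measure \<Rightarrow> ('a::euclidean_space, 'w) field_family \<Rightarrow> ('a, 'w) field_family set" where
  "gen_class M u = gen_rel M `` {u}"

text \<open>The operations of \<open>G_L0\<close> on classes: since the operations on representatives respect
  \<open>gen_rel\<close>, each union below is a union of identical classes.\<close>

definition gen_add :: "'w measure \<Rightarrow> ('a::euclidean_space, 'w) field_family set \<Rightarrow>
    ('a, 'w) field_family set \<Rightarrow> ('a, 'w) field_family set" where
  "gen_add M U V = (\<Union>u\<in>U. \<Union>v\<in>V. gen_class M (\<lambda>\<epsilon> x \<omega>. u \<epsilon> x \<omega> + v \<epsilon> x \<omega>))"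

definition gen_mult :: "'w measure \<Rightarrow> ('a::euclidean_space, 'w) field_family set \<Rightarrow>
    ('a, 'w) field_family set \<Rightarrow> ('a, 'w) field_family set" where
  "gen_mult M U V = (\<Union>u\<in>U. \<Union>v\<in>V. gen_class M (\<lambda>\<epsilon> x \<omega>. u \<epsilon> x \<omega> * v \<epsilon> x \<omega>))"

definition gen_sum :: "'w measure \<Rightarrow> ('n::finite \<Rightarrow> ('a::euclidean_space, 'w) field_family set) \<Rightarrow>
    ('a, 'w) field_family set" where
  "gen_sum M U = (\<Union>u\<in>{u. \<forall>j. u j \<in> U j}. gen_class M (\<lambda>\<epsilon> x \<omega>. \<Sum>j\<in>UNIV. u j \<epsilon> x \<omega>))"

definition gen_deriv :: "'w measure \<Rightarrow> 'a \<Rightarrow> ('a::euclidean_space, 'w) field_family set \<Rightarrow>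
    ('a, 'w) field_family set" where
  "gen_deriv M b U = (\<Union>u\<in>U. gen_class M (\<lambda>\<epsilon> x \<omega>. partial_deriv b (\<lambda>y. u \<epsilon> y \<omega>) x))"

text \<open>Points of the plane are pairs \<open>(x, t)\<close> of space and time.\<close>

definition restrict_t0 :: "'w measure \<Rightarrow> (real \<times> real, 'w) field_family set \<Rightarrow>
    (real, 'w) field_family set" where
  "restrict_t0 M U = (\<Union>u\<in>U. gen_class M (\<lambda>\<epsilon> x \<omega>. u \<epsilon> (x, 0) \<omega>))"

definition mollifier :: "('a::euclidean_space \<Rightarrow> real) \<Rightarrow> bool" where
  "mollifier \<rho> \<longleftrightarrow> schwartz \<rho> \<and> (\<integral>x. \<rho> x \<partial>lborel) = 1 \<and>
     (\<forall>\<alpha>\<in>multi_indices. length \<alpha> \<ge> 1 \<longrightarrow> (\<integral>x. monomial \<alpha> x * \<rho> x \<partial>lborel) = 0)"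

definition cutoff :: "('a::euclidean_space \<Rightarrow> real) \<Rightarrow> bool" where
  "cutoff \<theta> \<longleftrightarrow> test_function \<theta> \<and> (\<forall>\<^sub>F x in nhds 0. \<theta> x = 1)"

definition scaled :: "('a::euclidean_space \<Rightarrow> real) \<Rightarrow> real \<Rightarrow> 'a \<Rightarrow> real" where
  "scaled \<rho> \<epsilon> x = \<rho> (x /\<^sub>R \<epsilon>) / \<epsilon> ^ DIM('a)"

definition convolve :: "('a::euclidean_space \<Rightarrow> real) \<Rightarrow> ('a \<Rightarrow> real) \<Rightarrow> 'a \<Rightarrow> real" where
  "convolve f g x = (\<integral>y. f (x - y) * g y \<partial>lborel)"

definition iota :: "'w measure \<Rightarrow> ('a::euclidean_space \<Rightarrow> real) \<Rightarrow> ('a \<Rightarrow> real) \<Rightarrow>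
    ('a \<Rightarrow> 'w \<Rightarrow> real) \<Rightarrow> ('a, 'w) field_family set" where
  "iota M \<rho> \<theta> X =
     gen_class M (\<lambda>\<epsilon> x \<omega>. convolve (\<lambda>y. X y \<omega>) (\<lambda>y. \<theta> y * scaled \<rho> \<epsilon> y) x)"

text \<open>Association does not depend on the representative, so it is required of all of them.\<close>

definition associated :: "'w measure \<Rightarrow> ('a::euclidean_space, 'w) field_family set \<Rightarrow>
    ('a \<Rightarrow> 'w \<Rightarrow> real) \<Rightarrow> bool" where
  "associated M U v \<longleftrightarrow> (\<forall>u\<in>U. AE \<omega> in M. \<forall>\<phi>. test_function \<phi> \<longrightarrow>
     ((\<lambda>\<epsilon>. \<integral>x. u \<epsilon> x \<omega> * \<phi> x \<partial>lborel) \<longlongrightarrow> (\<integral>x. v x \<omega> * \<phi> x \<partial>lborel)) (at_right 0))"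

text \<open>The diagonal matrix of characteristic speeds is given by the vector of its diagonal entries.\<close>

definition cond_AL :: "'w measure \<Rightarrow> ('n::finite \<Rightarrow> real \<times> real \<Rightarrow> 'w \<Rightarrow> real) \<Rightarrow> bool" where
  "cond_AL M lam \<longleftrightarrow> (\<forall>K a b. compact K \<longrightarrow> (AE \<omega> in M. \<exists>l>0. \<forall>i. \<forall>x\<in>K. \<forall>y\<in>K. \<forall>t\<in>{a..b}.
     \<bar>lam i (x, t) \<omega> - lam i (y, t) \<omega>\<bar> \<le> l * \<bar>x - y\<bar>))"

definition cond_UB :: "'w measure \<Rightarrow> ('n::finite \<Rightarrow> real \<times> real \<Rightarrow> 'w \<Rightarrow> real) \<Rightarrow> bool" where
  "cond_UB M lam \<longleftrightarrow> (\<forall>a b. \<exists>c>0. \<forall>i. AE \<omega> in M. \<forall>x. \<forall>t\<in>{a..b}. \<bar>lam i (x, t) \<omega>\<bar> \<le> c)"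

definition classical_solution :: "'w measure \<Rightarrow> ('n::finite \<Rightarrow> real \<times> real \<Rightarrow> 'w \<Rightarrow> real) \<Rightarrow>
    ('n \<Rightarrow> 'n \<Rightarrow> real \<times> real \<Rightarrow> 'w \<Rightarrow> real) \<Rightarrow> ('n \<Rightarrow> real \<times> real \<Rightarrow> 'w \<Rightarrow> real) \<Rightarrow>
    ('n \<Rightarrow> real \<Rightarrow> 'w \<Rightarrow> real) \<Rightarrow> ('n \<Rightarrow> real \<times> real \<Rightarrow> 'w \<Rightarrow> real) \<Rightarrow> bool" where
  "classical_solution M lam f g u0 u \<longleftrightarrow>
     (\<forall>i. random_field M (u i) \<and> C1_paths M (u i)) \<and>
     (AE \<omega> in M. \<forall>i x t.
        partial_deriv (0, 1) (\<lambda>z. u i z \<omega>) (x, t)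
          + lam i (x, t) \<omega> * partial_deriv (1, 0) (\<lambda>z. u i z \<omega>) (x, t)
        = (\<Sum>j\<in>UNIV. f i j (x, t) \<omega> * u j (x, t) \<omega>) + g i (x, t) \<omega>) \<and>
     (AE \<omega> in M. \<forall>i x. u i (x, 0) \<omega> = u0 i x \<omega>)"

definition generalized_solution ::
    "'w measure \<Rightarrow> ('n::finite \<Rightarrow> (real \<times> real, 'w) field_family set) \<Rightarrow>
    ('n \<Rightarrow> 'n \<Rightarrow> (real \<times> real, 'w) field_family set) \<Rightarrow>
    ('n \<Rightarrow> (real \<times> real, 'w) field_family set) \<Rightarrow> ('n \<Rightarrow> (real, 'w) field_family set) \<Rightarrow>
    ('n \<Rightarrow> (real \<times> real, 'w) field_family set) \<Rightarrow> bool" where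
  "generalized_solution M lam f g u0 u \<longleftrightarrow>
     (\<forall>i. u i \<in> G_L0 M) \<and>
     (\<forall>i. gen_add M (gen_deriv M (0, 1) (u i)) (gen_mult M (lam i) (gen_deriv M (1, 0) (u i)))
        = gen_add M (gen_sum M (\<lambda>j. gen_mult M (f i j) (u j))) (g i)) \<and>
     (\<forall>i. restrict_t0 M (u i) = u0 i)"

end

theory Submission
  imports Defs
begin

text \<open>Fix a path \<open>\<omega>\<close>. The representatives satisfy the transport system with the mollified coefficients
  up to an error that tends to \<open>0\<close> locally uniformly, so \<open>w = u\<^sub>\<epsilon> - u\<degree>\<close> solves
  \<open>(\<partial>\<^sub>t + \<lambda>\<^sub>\<epsilon> \<partial>\<^sub>x) w = f\<^sub>\<epsilon> w + r\<^sub>\<epsilon>\<close> where \<open>r\<^sub>\<epsilon>\<close> and \<open>w(\<cdot>, 0)\<close> tend to \<open>0\<close> locally uniformly: since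
  \<open>u\<degree>\<close> is \<open>C\<^sup>1\<close>, the term \<open>(\<lambda>\<^sub>\<epsilon> - \<lambda>\<degree>) \<partial>\<^sub>x u\<degree>\<close> is part of \<open>r\<^sub>\<epsilon>\<close>. By (UB) the speeds are bounded by some
  \<open>C\<close> on a trapezoid with slanted sides of slope \<open>C\<close>. There \<open>\<bar>w\<^sub>i\<bar>\<close> stays below the barrier
  \<open>\<eta> exp ((A + 2) t)\<close>: at the first time of contact, the derivative of \<open>w\<^sub>i\<close> along the backward
  segment in the direction \<open>(\<lambda>\<^sub>\<epsilon>, 1)\<close>, which stays in the trapezoid, would be too large for the
  equation. Straight segments take the place of the characteristic curves.

  A generalized solution carries information only because the classes in its equation are nonempty: the class
  of a family that is not moderate is \<open>{}\<close>. Hence the embedded fields have to be shown to be moderate and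
  measurable in \<open>\<omega>\<close>.\<close>

subsection \<open>Smooth functions and their partial derivatives\<close>

text \<open>A representative is only moderate: no bound on \<open>v i\<close> or its derivatives
  that is uniform in \<epsilon> is known beforehand. So an error can be discarded only if the factor
  that it meets is known to converge, and this decides how the identity between classes is read. On
  its right side a member is written down with \<open>v\<close> itself next to the embedded matrix,
  so that no error is multiplied by \<open>v\<close>. On its left side the class dictates the
  representatives; what is exchanged there is the derivative of \<open>v\<close>, and its factor
  \<open>l\<close> converges to the speed, hence is locally bounded. \<open>l\<close> is kept as the
  coefficient of the regularized system, and all other errors, with negligibility weakened to
  locally uniform convergence to 0, are added to the source term.

  The contact argument evaluates the equation at a single point, where only the direction given by
  the speed counts. A first contact bounds all components at once, so the coupling through the
  matrix costs no more than in the scalar case.\<close>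

lemma has_partialsD:
  assumes "has_partials f" "b \<in> Basis"
  shows "((\<lambda>s. f (x + s *\<^sub>R b)) has_field_derivative partial_deriv b f (x + r *\<^sub>R b)) (at r)"
proof -
  \<comment> \<open>Differentiability is given at parameter 0 but for every base point; taking
    \<open>x + r *\<^sub>R b\<close> as base point yields it at parameter \<open>r\<close>.\<close>
  have "((\<lambda>s. f ((x + r *\<^sub>R b) + s *\<^sub>R b)) has_field_derivative partial_deriv b f (x + r *\<^sub>R b)) (at 0)"
    using assms unfolding has_partials_def partial_deriv_def
    by (intro DERIV_deriv_iff_field_differentiable[THEN iffD2]) blast
  then have "((\<lambda>s. f (x + (s + r) *\<^sub>R b)) has_field_derivative partial_deriv b f (x + r *\<^sub>R b)) (at 0)"
    by (simp add: algebra_simps)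
  then show ?thesis
    using DERIV_shift[of "\<lambda>s. f (x + s *\<^sub>R b)" "partial_deriv b f (x + r *\<^sub>R b)" 0 r]
    by simp
qed

lemma has_partialsD0:
  assumes "has_partials f" "b \<in> Basis"
  shows "((\<lambda>s. f (x + s *\<^sub>R b)) has_field_derivative partial_deriv b f x) (at 0)"
  using has_partialsD[OF assms, of x 0] by simp

lemma partial_derivI:
  "((\<lambda>s. f (x + s *\<^sub>R b)) has_field_derivative d) (at 0) \<Longrightarrow> partial_deriv b f x = d"
  unfolding partial_deriv_def by (rule DERIV_imp_deriv)

lemma has_partialsI:
  "(\<And>b x. b \<in> Basis \<Longrightarrow> ((\<lambda>s. f (x + s *\<^sub>R b)) has_field_derivative d b x) (at 0)) \<Longrightarrow> has_partials f"
  unfolding has_partials_def field_differentiable_def by blast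

lemma partial_deriv_add:
  "has_partials f \<Longrightarrow> has_partials g \<Longrightarrow> b \<in> Basis \<Longrightarrow>
    partial_deriv b (\<lambda>x. f x + g x) = (\<lambda>x. partial_deriv b f x + partial_deriv b g x)"
  by (intro ext partial_derivI derivative_eq_intros | erule (1) has_partialsD0 | simp)+

lemma partial_deriv_diff:
  "has_partials f \<Longrightarrow> has_partials g \<Longrightarrow> b \<in> Basis \<Longrightarrow>
    partial_deriv b (\<lambda>x. f x - g x) = (\<lambda>x. partial_deriv b f x - partial_deriv b g x)"
  by (intro ext partial_derivI derivative_eq_intros | erule (1) has_partialsD0 | simp)+

lemma partial_deriv_mult:
  "has_partials f \<Longrightarrow> has_partials g \<Longrightarrow> b \<in> Basis \<Longrightarrow>
    partial_deriv b (\<lambda>x. f x * g x) = (\<lambda>x. partial_deriv b f x * g x + partial_deriv b g x * f x)"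
  by (intro ext partial_derivI DERIV_cong[OF DERIV_mult] | erule (1) has_partialsD0 | simp)+

lemma partial_deriv_const [simp]: "partial_deriv b (\<lambda>x. c) = (\<lambda>x. 0)"
  by (simp add: partial_deriv_def fun_eq_iff)

lemma has_partials_const [simp]: "has_partials (\<lambda>x. c)"
  by (simp add: has_partials_def)

lemma has_partials_add: "has_partials f \<Longrightarrow> has_partials g \<Longrightarrow> has_partials (\<lambda>x. f x + g x)"
  and has_partials_mult: "has_partials f \<Longrightarrow> has_partials g \<Longrightarrow> has_partials (\<lambda>x. f x * g x)"
  by (auto simp: has_partials_def intro!: field_differentiable_add field_differentiable_mult)

lemma partial_deriv_scale:
  fixes f :: "'a::euclidean_space \<Rightarrow> real"
  assumes "has_partials f" "b \<in> Basis"
  shows "((\<lambda>s. c * f (r *\<^sub>R (x + s *\<^sub>R b))) has_field_derivative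
      (c * r) * partial_deriv b f (r *\<^sub>R x)) (at 0)"
proof -
  have "((\<lambda>s. f (r *\<^sub>R x + s *\<^sub>R b)) \<circ> (\<lambda>s. r * s) has_field_derivative partial_deriv b f (r *\<^sub>R x) * r) (at 0)"
    by (rule DERIV_chain) (auto intro!: derivative_eq_intros has_partialsD0 assms)
  from DERIV_cmult[OF this, of c] show ?thesis
    by (simp add: o_def algebra_simps)
qed

lemma C_k_imp_continuous: "C_k k f \<Longrightarrow> continuous_on UNIV f"
  by (cases k) auto

lemma C_k_Suc_imp: "C_k (Suc k) f \<Longrightarrow> C_k k f"
  by (induction k arbitrary: f) auto

lemma C_k_const [simp]: "C_k k (\<lambda>x. c)"
  by (induction k arbitrary: c) auto

lemma C_k_add: "C_k k f \<Longrightarrow> C_k k g \<Longrightarrow> C_k k (\<lambda>x. f x + g x)"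
  by (induction k arbitrary: f g)
    (auto intro!: continuous_intros has_partials_add simp: partial_deriv_add)

lemma C_k_mult: "C_k k f \<Longrightarrow> C_k k g \<Longrightarrow> C_k k (\<lambda>x. f x * g x)"
proof (induction k arbitrary: f g)
  case 0
  then show ?case by (auto intro!: continuous_intros)
next
  case (Suc k)
  \<comment> \<open>The product rule leaves one factor undifferentiated, so the factors themselves
    are needed at order \<open>k\<close> as well.\<close>
  then have fg: "C_k k f" "C_k k g" by (blast dest: C_k_Suc_imp)+
  from Suc fg show ?case
    by (auto intro!: continuous_intros has_partials_mult C_k_add simp: partial_deriv_mult)
qed

text \<open>Differentiating turns the factor \<open>c\<close> into \<open>c * r\<close>, which is
  why the induction runs over all \<open>f\<close> and \<open>c\<close>.\<close>

lemma C_k_scale: "C_k k f \<Longrightarrow> C_k k (\<lambda>x. c * f (r *\<^sub>R x))"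
proof (induction k arbitrary: f c)
  case 0
  then show ?case by (auto intro!: continuous_intros continuous_on_compose2[of UNIV f])
next
  case (Suc k)
  have "has_partials f" using Suc by simp
  then have "partial_deriv b (\<lambda>x. c * f (r *\<^sub>R x)) = (\<lambda>x. (c * r) * partial_deriv b f (r *\<^sub>R x))"
    if "b \<in> Basis" for b
    using that by (intro ext partial_derivI partial_deriv_scale)
  moreover have "has_partials (\<lambda>x. c * f (r *\<^sub>R x))"
    using Suc by (intro has_partialsI) (auto intro!: partial_deriv_scale)
  ultimately show ?case
    using Suc by (auto intro!: continuous_intros continuous_on_compose2[of UNIV f])
qed

lemma C_infinityD:
  assumes "C_infinity f"
  shows "continuous_on UNIV f" "has_partials f" "b \<in> Basis \<Longrightarrow> C_infinity (partial_deriv b f)"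
  using assms C_k.simps(2)[of _ f] unfolding C_infinity_def by blast+

lemma C_infinity_const [simp]: "C_infinity (\<lambda>x. c)"
  and C_infinity_add: "C_infinity f \<Longrightarrow> C_infinity g \<Longrightarrow> C_infinity (\<lambda>x. f x + g x)"
  and C_infinity_mult: "C_infinity f \<Longrightarrow> C_infinity g \<Longrightarrow> C_infinity (\<lambda>x. f x * g x)"
  and C_infinity_scale: "C_infinity f \<Longrightarrow> C_infinity (\<lambda>x. c * f (r *\<^sub>R x))"
  unfolding C_infinity_def by (auto intro: C_k_add C_k_mult C_k_scale)

lemma partial_derivs_Nil [simp]: "partial_derivs [] f = f"
  and partial_derivs_Cons: "partial_derivs (b # \<alpha>) f = partial_deriv b (partial_derivs \<alpha> f)"
  and partial_derivs_snoc: "partial_derivs (\<alpha> @ [b]) f = partial_derivs \<alpha> (partial_deriv b f)"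
  by (simp_all add: partial_derivs_def)

lemma multi_indices_simps [simp]:
  "[] \<in> multi_indices" "b # \<alpha> \<in> multi_indices \<longleftrightarrow> b \<in> Basis \<and> \<alpha> \<in> multi_indices"
  "\<alpha> @ \<beta> \<in> multi_indices \<longleftrightarrow> \<alpha> \<in> multi_indices \<and> \<beta> \<in> multi_indices"
  by (auto simp: multi_indices_def)

lemma C_infinity_partial_derivs:
  "C_infinity f \<Longrightarrow> \<alpha> \<in> multi_indices \<Longrightarrow> C_infinity (partial_derivs \<alpha> f)"
  by (induction \<alpha>) (auto simp: partial_derivs_Cons intro: C_infinityD)

lemma C_infinity_continuous: "C_infinity f \<Longrightarrow> continuous_on S f"
  by (rule continuous_on_subset[OF C_infinityD(1)]) auto

lemma continuous_on_partial_derivs: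
  "C_infinity f \<Longrightarrow> \<alpha> \<in> multi_indices \<Longrightarrow> continuous_on S (partial_derivs \<alpha> f)"
  by (intro C_infinity_continuous C_infinity_partial_derivs)

lemma partial_derivs_const: "partial_derivs \<alpha> (\<lambda>x. c) = (\<lambda>x. if \<alpha> = [] then c else 0)"
  by (induction \<alpha>) (auto simp: partial_derivs_Cons)

lemma partial_derivs_add:
  "C_infinity f \<Longrightarrow> C_infinity g \<Longrightarrow> \<alpha> \<in> multi_indices \<Longrightarrow>
    partial_derivs \<alpha> (\<lambda>x. f x + g x) = (\<lambda>x. partial_derivs \<alpha> f x + partial_derivs \<alpha> g x)"
  by (induction \<alpha>) (auto simp: partial_derivs_Cons
      intro!: partial_deriv_add C_infinityD(2) C_infinity_partial_derivs)

lemma partial_derivs_scale: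
  assumes "C_infinity f" "\<alpha> \<in> multi_indices"
  shows "partial_derivs \<alpha> (\<lambda>x. c * f (r *\<^sub>R x)) = (\<lambda>x. c * r ^ length \<alpha> * partial_derivs \<alpha> f (r *\<^sub>R x))"
  using assms(2)
proof (induction \<alpha>)
  case (Cons b \<alpha>)
  then have "has_partials (partial_derivs \<alpha> f)" "b \<in> Basis"
    using assms(1) by (auto intro: C_infinityD(2) C_infinity_partial_derivs)
  from partial_derivI[OF partial_deriv_scale[OF this, of "c * r ^ length \<alpha>" r]] Cons
  show ?case by (auto simp: partial_derivs_Cons algebra_simps)
qed simp

subsection \<open>Moderate and negligible families\<close>

lemma eventually_unit_interval: "\<forall>\<^sub>F \<epsilon> in at_right (0::real). \<epsilon> \<in> {0<..1}"
  using eventually_at_right_real[of 0 "1::real"] by (rule eventually_mono) auto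

text \<open>The bound is stated under the supremum: sums and products can then be estimated
  pointwise, and the empty set is harmless.\<close>

definition moderate_on :: "'a set \<Rightarrow> (real \<Rightarrow> 'a \<Rightarrow> real) \<Rightarrow> bool" where
  "moderate_on K u \<longleftrightarrow> (\<exists>a\<ge>0. \<exists>c\<ge>0. \<forall>\<^sub>F \<epsilon> in at_right 0. \<forall>x\<in>K. \<bar>u \<epsilon> x\<bar> \<le> c * \<epsilon> powr (-a))"

lemma bdd_above_abs_compact:
  fixes h :: "'a::topological_space \<Rightarrow> real"
  assumes "compact K" "continuous_on K h"
  shows "bdd_above ((\<lambda>x. \<bar>h x\<bar>) ` K)"
  using assms by (intro bounded_imp_bdd_above compact_imp_bounded compact_continuous_image
      continuous_intros)

text \<open>Continuity on a compact set bounds the values, as the real \<open>SUP\<close> requires,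
  and a point of \<open>K\<close> shows that the supremum is not negative.\<close>

lemma moderate_SUP_iff:
  fixes u :: "real \<Rightarrow> 'a::topological_space \<Rightarrow> real"
  assumes K: "compact K" "K \<noteq> {}" and cont: "\<And>\<epsilon>. \<epsilon> \<in> {0<..1} \<Longrightarrow> continuous_on K (u \<epsilon>)"
  shows "moderate (\<lambda>\<epsilon>. SUP x\<in>K. \<bar>u \<epsilon> x\<bar>) \<longleftrightarrow> moderate_on K u"
proof
  assume "moderate (\<lambda>\<epsilon>. SUP x\<in>K. \<bar>u \<epsilon> x\<bar>)"
  then obtain a where a: "a \<ge> 0" "(\<lambda>\<epsilon>. \<bar>SUP x\<in>K. \<bar>u \<epsilon> x\<bar>\<bar>) \<in> O[at_right 0](\<lambda>\<epsilon>. \<epsilon> powr (-a))"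
    unfolding moderate_def by blast
  from landau_o.bigE[OF a(2)] obtain c where c: "c > 0"
    "\<forall>\<^sub>F \<epsilon> in at_right 0. norm \<bar>SUP x\<in>K. \<bar>u \<epsilon> x\<bar>\<bar> \<le> c * norm (\<epsilon> powr (-a))" by blast
  have "\<forall>\<^sub>F \<epsilon> in at_right 0. \<forall>x\<in>K. \<bar>u \<epsilon> x\<bar> \<le> c * \<epsilon> powr (-a)"
    using c(2) eventually_unit_interval
  proof eventually_elim
    case (elim \<epsilon>)
    show ?case
    proof
      fix x assume "x \<in> K"
      then have "\<bar>u \<epsilon> x\<bar> \<le> (SUP x\<in>K. \<bar>u \<epsilon> x\<bar>)"
        using elim K cont by (intro cSUP_upper bdd_above_abs_compact)
      also have "\<dots> \<le> c * \<epsilon> powr (-a)" using elim by simp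
      finally show "\<bar>u \<epsilon> x\<bar> \<le> c * \<epsilon> powr (-a)" .
    qed
  qed
  with a(1) c(1) show "moderate_on K u" unfolding moderate_on_def by (meson less_imp_le)
next
  assume "moderate_on K u"
  then obtain a c where ac: "a \<ge> 0" "c \<ge> 0"
    "\<forall>\<^sub>F \<epsilon> in at_right 0. \<forall>x\<in>K. \<bar>u \<epsilon> x\<bar> \<le> c * \<epsilon> powr (-a)" unfolding moderate_on_def by blast
  have "\<forall>\<^sub>F \<epsilon> in at_right 0. norm \<bar>SUP x\<in>K. \<bar>u \<epsilon> x\<bar>\<bar> \<le> c * norm (\<epsilon> powr (-a))"
    using ac(3) eventually_unit_interval
  proof eventually_elim
    case (elim \<epsilon>)
    obtain x0 where x0: "x0 \<in> K" using K by blast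
    have "0 \<le> \<bar>u \<epsilon> x0\<bar>" by simp
    also have "\<dots> \<le> (SUP x\<in>K. \<bar>u \<epsilon> x\<bar>)"
      using elim K cont x0 by (intro cSUP_upper bdd_above_abs_compact)
    finally have "0 \<le> (SUP x\<in>K. \<bar>u \<epsilon> x\<bar>)" .
    moreover have "(SUP x\<in>K. \<bar>u \<epsilon> x\<bar>) \<le> c * \<epsilon> powr (-a)"
      using K elim by (intro cSUP_least) auto
    ultimately show ?case by simp
  qed
  then have "(\<lambda>\<epsilon>. \<bar>SUP x\<in>K. \<bar>u \<epsilon> x\<bar>\<bar>) \<in> O[at_right 0](\<lambda>\<epsilon>. \<epsilon> powr (-a))"
    by (intro bigoI) 
  with ac(1) show "moderate (\<lambda>\<epsilon>. SUP x\<in>K. \<bar>u \<epsilon> x\<bar>)" unfolding moderate_def by blast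
qed

lemma moderate_on_add:
  assumes "moderate_on K u" "moderate_on K v"
  shows "moderate_on K (\<lambda>\<epsilon> x. u \<epsilon> x + v \<epsilon> x)"
proof -
  from assms obtain a c b d where
    u: "a \<ge> 0" "c \<ge> 0" "\<forall>\<^sub>F \<epsilon> in at_right 0. \<forall>x\<in>K. \<bar>u \<epsilon> x\<bar> \<le> c * \<epsilon> powr (-a)" and
    v: "b \<ge> 0" "d \<ge> 0" "\<forall>\<^sub>F \<epsilon> in at_right 0. \<forall>x\<in>K. \<bar>v \<epsilon> x\<bar> \<le> d * \<epsilon> powr (-b)"
    unfolding moderate_on_def by blast
  have "\<forall>\<^sub>F \<epsilon> in at_right 0. \<forall>x\<in>K. \<bar>u \<epsilon> x + v \<epsilon> x\<bar> \<le> (c + d) * \<epsilon> powr (-(max a b))"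
    using u(3) v(3) eventually_unit_interval
  proof eventually_elim
    case (elim \<epsilon>)
    \<comment> \<open>Since \<epsilon> is at most 1, the larger of the two exponents gives the
      larger bound.\<close>
    then have "\<epsilon> powr (-a) \<le> \<epsilon> powr (-(max a b))" "\<epsilon> powr (-b) \<le> \<epsilon> powr (-(max a b))"
      by (intro powr_mono'; simp)+
    then have le: "c * \<epsilon> powr (-a) \<le> c * \<epsilon> powr (-(max a b))" "d * \<epsilon> powr (-b) \<le> d * \<epsilon> powr (-(max a b))"
      using u v by (intro mult_left_mono; simp)+
    show ?case
    proof
      fix x assume "x \<in> K"
      with elim have "\<bar>u \<epsilon> x\<bar> \<le> c * \<epsilon> powr (-a)" "\<bar>v \<epsilon> x\<bar> \<le> d * \<epsilon> powr (-b)" by blast+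
      with le show "\<bar>u \<epsilon> x + v \<epsilon> x\<bar> \<le> (c + d) * \<epsilon> powr (-(max a b))"
        unfolding distrib_right by linarith
    qed
  qed
  then show ?thesis
    using u v unfolding moderate_on_def by (intro exI[of _ "max a b"] conjI exI[of _ "c + d"]) auto
qed

lemma moderate_on_mult:
  assumes "moderate_on K u" "moderate_on K v"
  shows "moderate_on K (\<lambda>\<epsilon> x. u \<epsilon> x * v \<epsilon> x)"
proof -
  from assms obtain a c b d where
    u: "a \<ge> 0" "c \<ge> 0" "\<forall>\<^sub>F \<epsilon> in at_right 0. \<forall>x\<in>K. \<bar>u \<epsilon> x\<bar> \<le> c * \<epsilon> powr (-a)" and
    v: "b \<ge> 0" "d \<ge> 0" "\<forall>\<^sub>F \<epsilon> in at_right 0. \<forall>x\<in>K. \<bar>v \<epsilon> x\<bar> \<le> d * \<epsilon> powr (-b)"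
    unfolding moderate_on_def by blast
  have "\<forall>\<^sub>F \<epsilon> in at_right 0. \<forall>x\<in>K. \<bar>u \<epsilon> x * v \<epsilon> x\<bar> \<le> (c * d) * \<epsilon> powr (-(a + b))"
    using u(3) v(3) eventually_unit_interval
  proof eventually_elim
    case (elim \<epsilon>)
    show ?case
    proof
      fix x assume "x \<in> K"
      with elim have "\<bar>u \<epsilon> x\<bar> * \<bar>v \<epsilon> x\<bar> \<le> (c * \<epsilon> powr (-a)) * (d * \<epsilon> powr (-b))"
        using u v by (intro mult_mono) auto
      then show "\<bar>u \<epsilon> x * v \<epsilon> x\<bar> \<le> (c * d) * \<epsilon> powr (-(a + b))"
        using powr_add[of \<epsilon> "-a" "-b"] by (simp add: abs_mult algebra_simps)
    qed
  qed
  then show ?thesis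
    using u v unfolding moderate_on_def by (intro exI[of _ "a + b"] conjI exI[of _ "c * d"]) auto
qed

lemma moderate_on_const_family:
  fixes h :: "'a::topological_space \<Rightarrow> real"
  assumes "compact K" "continuous_on K h"
  shows "moderate_on K (\<lambda>\<epsilon>. h)"
proof -
  obtain B where B: "\<And>x. x \<in> K \<Longrightarrow> \<bar>h x\<bar> \<le> B"
    using bdd_above_abs_compact[OF assms] by (auto simp: bdd_above_def)
  have "\<forall>\<^sub>F \<epsilon> in at_right 0. \<forall>x\<in>K. \<bar>h x\<bar> \<le> max B 0 * \<epsilon> powr (-0)"
    using eventually_unit_interval
    by eventually_elim (auto dest!: B)
  then show ?thesis unfolding moderate_on_def by (meson max.cobounded2 order.refl)
qed

lemma E_M_iff:
  "u \<in> E_M \<longleftrightarrow> (\<forall>\<epsilon>\<in>{0<..1}. C_infinity (u \<epsilon>)) \<and>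
     (\<forall>K. \<forall>\<alpha>\<in>multi_indices. compact K \<longrightarrow> moderate_on K (\<lambda>\<epsilon>. partial_derivs \<alpha> (u \<epsilon>)))"
proof (cases "\<forall>\<epsilon>\<in>{0<..1}. C_infinity (u \<epsilon>)")
  case True
  have "moderate_on {} w" for w :: "real \<Rightarrow> 'a \<Rightarrow> real"
    unfolding moderate_on_def by (intro exI[of _ 0]) auto
  moreover have "moderate (\<lambda>\<epsilon>. SUP x\<in>K. \<bar>partial_derivs \<alpha> (u \<epsilon>) x\<bar>) \<longleftrightarrow>
      moderate_on K (\<lambda>\<epsilon>. partial_derivs \<alpha> (u \<epsilon>))"
    if "compact K" "K \<noteq> {}" "\<alpha> \<in> multi_indices" for K \<alpha>
    using that True
    by (intro moderate_SUP_iff)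
      (auto intro: continuous_on_partial_derivs)
  ultimately show ?thesis using True unfolding E_M_def by blast
qed (auto simp: E_M_def)

lemma moderate_on_cong:
  assumes "\<And>\<epsilon> x. \<epsilon> \<in> {0<..1} \<Longrightarrow> x \<in> K \<Longrightarrow> u \<epsilon> x = v \<epsilon> x" "moderate_on K v"
  shows "moderate_on K u"
proof -
  from assms(2) obtain a c where *: "a \<ge> 0" "c \<ge> 0"
    "\<forall>\<^sub>F \<epsilon> in at_right 0. \<forall>x\<in>K. \<bar>v \<epsilon> x\<bar> \<le> c * \<epsilon> powr (-a)"
    unfolding moderate_on_def by blast
  have "\<forall>\<^sub>F \<epsilon> in at_right 0. \<forall>x\<in>K. \<bar>u \<epsilon> x\<bar> \<le> c * \<epsilon> powr (-a)"
    using *(3) eventually_unit_interval by eventually_elim (simp add: assms(1))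
  with * show ?thesis unfolding moderate_on_def by blast
qed

lemma E_M_add:
  assumes "u \<in> E_M" "v \<in> E_M"
  shows "(\<lambda>\<epsilon> x. u \<epsilon> x + v \<epsilon> x) \<in> E_M"
  unfolding E_M_iff
proof (intro conjI allI ballI impI)
  fix K :: "'a set" and \<alpha> :: "'a list" assume K: "compact K" "\<alpha> \<in> multi_indices"
  with assms have "moderate_on K (\<lambda>\<epsilon>. partial_derivs \<alpha> (u \<epsilon>))"
      "moderate_on K (\<lambda>\<epsilon>. partial_derivs \<alpha> (v \<epsilon>))"
    by (auto simp: E_M_iff)
  from moderate_on_add[OF this]
  show "moderate_on K (\<lambda>\<epsilon>. partial_derivs \<alpha> (\<lambda>x. u \<epsilon> x + v \<epsilon> x))"
    by (rule moderate_on_cong[rotated]) (use assms K in \<open>auto simp: E_M_iff partial_derivs_add\<close>)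
qed (use assms in \<open>auto simp: E_M_iff intro: C_infinity_add\<close>)

lemma E_M_partial_deriv:
  assumes "u \<in> E_M" "b \<in> Basis"
  shows "(\<lambda>\<epsilon>. partial_deriv b (u \<epsilon>)) \<in> E_M"
  unfolding E_M_iff
proof (intro conjI allI ballI impI)
  fix K :: "'a set" and \<alpha> :: "'a list" assume K: "compact K" "\<alpha> \<in> multi_indices"
  with assms have "moderate_on K (\<lambda>\<epsilon>. partial_derivs (\<alpha> @ [b]) (u \<epsilon>))"
    by (simp add: E_M_iff)
  then show "moderate_on K (\<lambda>\<epsilon>. partial_derivs \<alpha> (partial_deriv b (u \<epsilon>)))"
    by (simp add: partial_derivs_snoc)
qed (use assms in \<open>auto simp: E_M_iff intro: C_infinityD\<close>)

text \<open>The induction strips the innermost derivative instead of using the full Leibniz formula: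
  the product rule leaves two products whose factors are again in \<open>E_M\<close>, and the
  induction hypothesis holds for all pairs of factors.\<close>

lemma E_M_mult:
  assumes "u \<in> E_M" "v \<in> E_M"
  shows "(\<lambda>\<epsilon> x. u \<epsilon> x * v \<epsilon> x) \<in> E_M"
  unfolding E_M_iff
proof (intro conjI allI ballI impI)
  fix K :: "'a set" and \<alpha> :: "'a list" assume K: "compact K" "\<alpha> \<in> multi_indices"
  from K(2) assms show "moderate_on K (\<lambda>\<epsilon>. partial_derivs \<alpha> (\<lambda>x. u \<epsilon> x * v \<epsilon> x))"
  proof (induction \<alpha> arbitrary: u v rule: rev_induct)
    case Nil
    then have "moderate_on K (\<lambda>\<epsilon>. partial_derivs [] (u \<epsilon>))"
        "moderate_on K (\<lambda>\<epsilon>. partial_derivs [] (v \<epsilon>))"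
      using K(1) multi_indices_simps(1) unfolding E_M_iff by blast+
    then show ?case by (simp add: moderate_on_mult)
  next
    case (snoc b \<alpha>)
    let ?D = "\<lambda>u \<epsilon>. partial_deriv b (u \<epsilon>)"
    have b: "b \<in> Basis" and \<alpha>: "\<alpha> \<in> multi_indices" using snoc.prems by auto
    have D: "?D u \<in> E_M" "?D v \<in> E_M" using snoc.prems b by (auto intro: E_M_partial_deriv)
    have "partial_derivs (\<alpha> @ [b]) (\<lambda>x. u \<epsilon> x * v \<epsilon> x) =
        (\<lambda>x. partial_derivs \<alpha> (\<lambda>x. ?D u \<epsilon> x * v \<epsilon> x) x + partial_derivs \<alpha> (\<lambda>x. ?D v \<epsilon> x * u \<epsilon> x) x)"
      if "\<epsilon> \<in> {0<..1}" for \<epsilon>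
    proof -
      have C: "C_infinity (u \<epsilon>)" "C_infinity (v \<epsilon>)" using snoc.prems that by (auto simp: E_M_iff)
      then have "partial_derivs (\<alpha> @ [b]) (\<lambda>x. u \<epsilon> x * v \<epsilon> x) =
          partial_derivs \<alpha> (\<lambda>x. ?D u \<epsilon> x * v \<epsilon> x + ?D v \<epsilon> x * u \<epsilon> x)"
        by (simp add: partial_derivs_snoc partial_deriv_mult C_infinityD b)
      also have "\<dots> = (\<lambda>x. partial_derivs \<alpha> (\<lambda>x. ?D u \<epsilon> x * v \<epsilon> x) x +
          partial_derivs \<alpha> (\<lambda>x. ?D v \<epsilon> x * u \<epsilon> x) x)"
        using C b \<alpha> by (intro partial_derivs_add C_infinity_mult C_infinityD)
      finally show ?thesis .
    qed
    then show ?case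
      by (intro moderate_on_cong[OF _ moderate_on_add[OF snoc.IH[OF \<alpha> D(1) snoc.prems(3)]
          snoc.IH[OF \<alpha> D(2) snoc.prems(2)]]]) simp
  qed
qed (use assms in \<open>auto simp: E_M_iff intro: C_infinity_mult\<close>)

lemma E_M_const_family: "C_infinity h \<Longrightarrow> (\<lambda>\<epsilon>. h) \<in> E_M"
  by (simp add: E_M_iff moderate_on_const_family continuous_on_partial_derivs)

lemma E_M_sum:
  "(\<And>j. j \<in> J \<Longrightarrow> u j \<in> E_M) \<Longrightarrow> (\<lambda>\<epsilon> x. \<Sum>j\<in>J. u j \<epsilon> x) \<in> E_M"
  by (induction J rule: infinite_finite_induct) (auto intro!: E_M_const_family E_M_add)

section \<open>Locally uniform convergence and what negligibility gives for it\<close>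

definition loc_unif :: "(real \<Rightarrow> 'a::topological_space \<Rightarrow> real) \<Rightarrow> ('a \<Rightarrow> real) \<Rightarrow> bool" where
  "loc_unif u v \<longleftrightarrow> (\<forall>K. compact K \<longrightarrow> uniform_limit K u v (at_right 0))"

text \<open>Negligibility of order 1 suffices, since it bounds the suprema by
  \<open>c * \<epsilon>\<close>. All later estimates use negligible families in this weakened
  form.\<close>

lemma N_ideal_loc_unif:
  fixes u :: "real \<Rightarrow> 'a::euclidean_space \<Rightarrow> real"
  assumes "u \<in> N_ideal" "\<alpha> \<in> multi_indices"
  shows "loc_unif (\<lambda>\<epsilon>. partial_derivs \<alpha> (u \<epsilon>)) (\<lambda>x. 0)"
  unfolding loc_unif_def
proof (intro allI impI)
  fix K :: "'a set" assume K: "compact K"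
  show "uniform_limit K (\<lambda>\<epsilon>. partial_derivs \<alpha> (u \<epsilon>)) (\<lambda>x. 0) (at_right 0)"
  proof (cases "K = {}")
    case False
    with assms K have "negligible_family (\<lambda>\<epsilon>. SUP x\<in>K. \<bar>partial_derivs \<alpha> (u \<epsilon>) x\<bar>)"
      unfolding N_ideal_def by blast
    then have "(\<lambda>\<epsilon>. \<bar>SUP x\<in>K. \<bar>partial_derivs \<alpha> (u \<epsilon>) x\<bar>\<bar>) \<in> O[at_right 0](\<lambda>\<epsilon>. \<epsilon> powr 1)"
      unfolding negligible_family_def by (metis zero_le_one)
    from landau_o.bigE[OF this] obtain c where c: "c > 0"
      "\<forall>\<^sub>F \<epsilon> in at_right 0. norm \<bar>SUP x\<in>K. \<bar>partial_derivs \<alpha> (u \<epsilon>) x\<bar>\<bar> \<le> c * norm (\<epsilon> powr 1)" by blast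
    show ?thesis
    proof (rule uniform_limitI)
      fix e :: real assume "e > 0"
      then have "\<forall>\<^sub>F \<epsilon> in at_right 0. \<epsilon> \<in> {0<..<e / c}"
        using c(1) by (intro eventually_at_right_real) auto
      with c(2) eventually_unit_interval
      show "\<forall>\<^sub>F \<epsilon> in at_right 0. \<forall>x\<in>K. dist (partial_derivs \<alpha> (u \<epsilon>) x) 0 < e"
      proof eventually_elim
        case (elim \<epsilon>)
        then have "C_infinity (partial_derivs \<alpha> (u \<epsilon>))"
          using assms by (auto simp: N_ideal_def intro: C_infinity_partial_derivs)
        then have "\<bar>partial_derivs \<alpha> (u \<epsilon>) x\<bar> \<le> (SUP x\<in>K. \<bar>partial_derivs \<alpha> (u \<epsilon>) x\<bar>)" if "x \<in> K" for x
          using K that by (intro cSUP_upper bdd_above_abs_compact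
              C_infinity_continuous)
        moreover have "(SUP x\<in>K. \<bar>partial_derivs \<alpha> (u \<epsilon>) x\<bar>) \<le> c * \<epsilon>" using elim by simp
        moreover have "c * \<epsilon> < e" using elim c(1) by (simp add: field_simps)
        ultimately show ?case by fastforce
      qed
    qed
  qed (simp add: uniform_limit_iff)
qed

lemma N_ideal_zero: "(\<lambda>\<epsilon> x. 0) \<in> N_ideal"
  by (auto simp: N_ideal_def negligible_family_def partial_derivs_const)

subsection \<open>Convolution with a test function\<close>

text \<open>A radius stands for the support: all derivatives share it, and it can be the same for
  all \<epsilon>.\<close>

definition supp_in :: "real \<Rightarrow> ('a::euclidean_space \<Rightarrow> real) \<Rightarrow> bool" where
  "supp_in R \<psi> \<longleftrightarrow> (\<forall>y. norm y > R \<longrightarrow> \<psi> y = 0)"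

text \<open>At a point outside the closed ball the function is 0 on a whole neighbourhood, hence so
  is its derivative there.\<close>

lemma partial_deriv_supp_in:
  assumes "supp_in R \<psi>"
  shows "supp_in R (partial_deriv b \<psi>)"
  unfolding supp_in_def
proof (intro allI impI)
  fix y :: 'a assume y: "R < norm y"
  have "((\<lambda>s. norm (y + s *\<^sub>R b)) \<longlongrightarrow> norm (y + 0 *\<^sub>R b)) (nhds 0)"
    by (intro tendsto_intros filterlim_ident)
  then have "\<forall>\<^sub>F s in nhds 0. R < norm (y + s *\<^sub>R b)"
    using y by (intro order_tendstoD) auto
  then have "\<forall>\<^sub>F s in nhds 0. \<psi> (y + s *\<^sub>R b) = 0"
    by eventually_elim (use assms in \<open>auto simp: supp_in_def\<close>)
  then have "((\<lambda>s. \<psi> (y + s *\<^sub>R b)) has_field_derivative 0) (at 0) \<longleftrightarrow>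
      ((\<lambda>s. 0::real) has_field_derivative 0) (at (0::real))"
    by (intro DERIV_cong_ev) auto
  then show "partial_deriv b \<psi> y = 0" by (intro partial_derivI) simp
qed

lemma partial_derivs_supp_in: "supp_in R \<psi> \<Longrightarrow> supp_in R (partial_derivs \<alpha> \<psi>)"
  by (induction \<alpha>) (auto simp: partial_derivs_Cons intro: partial_deriv_supp_in)

text \<open>Passing to the gauge integral over a box gives access to continuity in a parameter and
  to differentiation under the integral sign.\<close>

lemma integral_lborel_cbox:
  fixes h :: "'a::euclidean_space \<Rightarrow> real"
  assumes "continuous_on UNIV h" "\<And>y. y \<notin> cbox p q \<Longrightarrow> h y = 0"
  shows "integrable lborel h" "integral\<^sup>L lborel h = integral (cbox p q) h"
proof -
  have eq: "h = (\<lambda>y. indicator (cbox p q) y *\<^sub>R h y)"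
    using assms(2) by (auto simp: indicator_def fun_eq_iff)
  have "continuous_on (cbox p q) h" using assms(1) by (rule continuous_on_subset) auto
  then have "integrable lborel (\<lambda>y. indicator (cbox p q) y *\<^sub>R h y)"
    by (intro borel_integrable_compact) auto
  then show "integrable lborel h" "integral\<^sup>L lborel h = integral (cbox p q) h"
    using eq set_borel_integral_eq_integral[of "cbox p q" h]
    by (simp_all add: set_integrable_def set_lebesgue_integral_def)
qed

lemma cball_subset_cbox:
  obtains p q where "cball (x::'a::euclidean_space) R \<subseteq> cbox p q"
  using bounded_subset_cbox_symmetric[OF bounded_cball, of x R] by metis

text \<open>With \<open>h y = X y * \<psi> (x - y)\<close> this carries the variable
  \<open>x\<close> of a convolution over to the kernel, the factor that can be
  differentiated.\<close>

lemma integral_reflect_translate: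
  fixes h :: "'a::euclidean_space \<Rightarrow> real"
  assumes "h \<in> borel_measurable borel"
  shows "(\<integral>y. h (x - y) \<partial>lborel) = (\<integral>y. h y \<partial>lborel)"
proof -
  have "lborel = distr lborel borel (\<lambda>y::'a. x + (-1) *\<^sub>R y)"
    using lborel_affine[of "-1" x] by (simp add: density_1)
  then have "(\<integral>y. h y \<partial>lborel) = (\<integral>y. h y \<partial>distr lborel borel (\<lambda>y::'a. x + (-1) *\<^sub>R y))"
    by simp
  also have "\<dots> = (\<integral>y. h (x + (-1) *\<^sub>R y) \<partial>lborel)"
    using assms by (intro integral_distr) auto
  finally show ?thesis by simp
qed

lemma integral_scale:
  fixes h :: "'a::euclidean_space \<Rightarrow> real"
  assumes "h \<in> borel_measurable borel" "\<epsilon> > 0"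
  shows "(\<integral>y. h y / \<epsilon> ^ DIM('a) \<partial>lborel) = (\<integral>z. h (\<epsilon> *\<^sub>R z) \<partial>lborel)"
proof -
  have "lborel = density (distr lborel borel (\<lambda>y::'a. 0 + \<epsilon> *\<^sub>R y)) (\<lambda>_. \<bar>\<epsilon>\<bar> ^ DIM('a))"
    using assms by (intro lborel_affine) auto
  then have "(\<integral>y. h y / \<epsilon> ^ DIM('a) \<partial>lborel) = (\<integral>y. h y / \<epsilon> ^ DIM('a)
      \<partial>density (distr lborel borel (\<lambda>y::'a. 0 + \<epsilon> *\<^sub>R y)) (\<lambda>_. \<bar>\<epsilon>\<bar> ^ DIM('a)))"
    by simp
  also have "\<dots> = (\<integral>y. \<bar>\<epsilon>\<bar> ^ DIM('a) *\<^sub>R (h y / \<epsilon> ^ DIM('a))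
      \<partial>distr lborel borel (\<lambda>y::'a. 0 + \<epsilon> *\<^sub>R y))"
    using assms by (intro integral_density) auto
  also have "\<dots> = (\<integral>y. h y \<partial>distr lborel borel (\<lambda>y::'a. 0 + \<epsilon> *\<^sub>R y))"
    using assms(2) by simp
  also have "\<dots> = (\<integral>y. h (0 + \<epsilon> *\<^sub>R y) \<partial>lborel)"
    using assms by (intro integral_distr) auto
  finally show ?thesis by simp
qed

lemma borel_measurable_continuous_mult:
  fixes X \<psi> :: "'a::euclidean_space \<Rightarrow> real"
  assumes X: "continuous_on UNIV X" and \<psi>: "continuous_on UNIV \<psi>"
  shows "(\<lambda>y. X y * \<psi> (x - y)) \<in> borel_measurable borel"
  by (intro borel_measurable_continuous_onI continuous_intros X continuous_on_compose2[OF \<psi>]) auto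

lemma continuous_on_convolve:
  fixes X \<psi> :: "'a::euclidean_space \<Rightarrow> real"
  assumes X: "continuous_on UNIV X" and \<psi>: "continuous_on UNIV \<psi>" "supp_in R \<psi>"
  shows "continuous_on UNIV (convolve X \<psi>)"
proof -
  obtain p q where pq: "cball (0::'a) R \<subseteq> cbox p q" by (rule cball_subset_cbox)
  have "convolve X \<psi> = (\<lambda>x. integral (cbox p q) (\<lambda>y. X (x - y) * \<psi> y))"
    unfolding convolve_def
  proof (intro ext integral_lborel_cbox)
    fix x
    show "continuous_on UNIV (\<lambda>y. X (x - y) * \<psi> y)"
      using \<psi>(1) by (intro continuous_intros continuous_on_compose2[OF X]) auto
    show "X (x - y) * \<psi> y = 0" if "y \<notin> cbox p q" for y
    proof -
      have "R < norm y" using that pq by (auto simp: subset_iff not_le)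
      then show ?thesis using \<psi>(2) by (simp add: supp_in_def)
    qed
  qed
  moreover have "continuous_on (UNIV \<times> cbox p q) (\<lambda>(x, y). X (x - y) * \<psi> y)"
    unfolding split_beta
    by (intro continuous_intros continuous_on_compose2[OF X] continuous_on_compose2[OF \<psi>(1)]) auto
  ultimately show ?thesis by (simp add: integral_continuous_on_param)
qed

text \<open>\<open>X\<close> is merely continuous, so the derivative has to fall on the kernel.
  After the reflection the parameter \<open>s\<close> occurs in \<psi> only, and the Leibniz rule
  applies on a box that does not depend on \<open>s\<close>.\<close>

lemma has_derivative_convolve:
  fixes X \<psi> :: "'a::euclidean_space \<Rightarrow> real"
  assumes X: "continuous_on UNIV X" and \<psi>: "C_infinity \<psi>" "supp_in R \<psi>" and b: "b \<in> Basis"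
  shows "((\<lambda>s. convolve X \<psi> (x + s *\<^sub>R b)) has_field_derivative convolve X (partial_deriv b \<psi>) x) (at 0)"
proof -
  \<comment> \<open>For \<open>s\<close> in \<open>{-1..1}\<close> the support of the shifted kernel
    moves by at most 1; hence the radius \<open>R + 1\<close>.\<close>
  obtain p q where pq: "cball x (R + 1) \<subseteq> cbox p q" by (rule cball_subset_cbox)
  have conv: "convolve X \<phi> (x + s *\<^sub>R b) = integral (cbox p q) (\<lambda>y. X y * \<phi> (x + s *\<^sub>R b - y))"
      "(\<lambda>y. X y * \<phi> (x + s *\<^sub>R b - y)) integrable_on cbox p q"
    if s: "s \<in> {-1..1}" and \<phi>: "continuous_on UNIV \<phi>" "supp_in R \<phi>" for s \<phi>
  proof -
    let ?h = "\<lambda>y. X y * \<phi> (x + s *\<^sub>R b - y)"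
    have cont: "continuous_on UNIV ?h"
      using X by (intro continuous_intros continuous_on_compose2[OF \<phi>(1)]) auto
    have "?h y = 0" if "y \<notin> cbox p q" for y
    proof -
      have "R + 1 < norm (x - y)" using that pq by (auto simp: dist_norm subset_iff not_le)
      moreover have "norm (s *\<^sub>R b) \<le> 1" using s b by auto
      moreover have "norm (x - y) \<le> norm (x + s *\<^sub>R b - y) + norm (s *\<^sub>R b)"
        using norm_triangle_ineq4[of "x + s *\<^sub>R b - y" "s *\<^sub>R b"] by simp
      ultimately show ?thesis using \<phi>(2) by (auto simp: supp_in_def)
    qed
    from integral_lborel_cbox(2)[OF cont this]
    have "(\<integral>y. ?h y \<partial>lborel) = integral (cbox p q) ?h" by blast
    moreover have "convolve X \<phi> (x + s *\<^sub>R b) = (\<integral>y. ?h y \<partial>lborel)"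
      using integral_reflect_translate[OF borel_measurable_continuous_mult[OF X \<phi>(1), of "x + s *\<^sub>R b"],
          of "x + s *\<^sub>R b"]
      by (simp add: convolve_def)
    ultimately show "convolve X \<phi> (x + s *\<^sub>R b) = integral (cbox p q) ?h" by simp
    show "?h integrable_on cbox p q"
      by (intro integrable_continuous continuous_on_subset[OF cont]) auto
  qed
  have D\<psi>: "continuous_on UNIV (partial_deriv b \<psi>)" "supp_in R (partial_deriv b \<psi>)"
    using \<psi> b by (auto intro: C_infinityD partial_deriv_supp_in)
  have "((\<lambda>s. integral (cbox p q) (\<lambda>y. X y * \<psi> (x + s *\<^sub>R b - y))) has_field_derivative
      integral (cbox p q) (\<lambda>y. X y * partial_deriv b \<psi> (x + 0 *\<^sub>R b - y))) (at 0 within {-1..1})"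
  proof (rule leibniz_rule_field_derivative)
    fix s :: real and y assume "s \<in> {-1..1}"
    have "((\<lambda>s. \<psi> ((x - y) + s *\<^sub>R b)) has_field_derivative
        partial_deriv b \<psi> ((x - y) + s *\<^sub>R b)) (at s)"
      using \<psi>(1) b by (intro has_partialsD C_infinityD)
    from DERIV_cmult[OF this, of "X y"] have "((\<lambda>s. X y * \<psi> (x + s *\<^sub>R b - y)) has_field_derivative
        X y * partial_deriv b \<psi> (x + s *\<^sub>R b - y)) (at s)"
      by (simp add: algebra_simps)
    then show "((\<lambda>s. X y * \<psi> (x + s *\<^sub>R b - y)) has_field_derivative
        X y * partial_deriv b \<psi> (x + s *\<^sub>R b - y)) (at s within {-1..1})"
      by (rule has_field_derivative_at_within)
  next
    show "continuous_on ({-1..1} \<times> cbox p q) (\<lambda>(s, y). X y * partial_deriv b \<psi> (x + s *\<^sub>R b - y))"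
      unfolding split_beta
      by (intro continuous_intros continuous_on_compose2[OF X] continuous_on_compose2[OF D\<psi>(1)]) auto
  qed (use conv(2)[OF _ C_infinityD(1)[OF \<psi>(1)] \<psi>(2)] in auto)
  moreover have "at (0::real) within {-1..1} = at 0" by (rule at_within_interior) auto
  moreover have "integral (cbox p q) (\<lambda>y. X y * partial_deriv b \<psi> (x + 0 *\<^sub>R b - y)) =
      convolve X (partial_deriv b \<psi>) x"
    using conv(1)[OF _ D\<psi>, of 0] by simp
  ultimately have *: "((\<lambda>s. integral (cbox p q) (\<lambda>y. X y * \<psi> (x + s *\<^sub>R b - y))) has_field_derivative
      convolve X (partial_deriv b \<psi>) x) (at 0)" by simp
  show ?thesis
  proof (rule has_field_derivative_transform_within_open[OF *])
    show "open {-1<..<1::real}" by auto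
  qed (use conv(1)[OF _ C_infinityD(1)[OF \<psi>(1)] \<psi>(2)] in auto)
qed

lemma partial_derivs_convolve:
  fixes X \<psi> :: "'a::euclidean_space \<Rightarrow> real"
  assumes "continuous_on UNIV X" "C_infinity \<psi>" "supp_in R \<psi>" "\<alpha> \<in> multi_indices"
  shows "partial_derivs \<alpha> (convolve X \<psi>) = convolve X (partial_derivs \<alpha> \<psi>)"
  using assms(4)
proof (induction \<alpha>)
  case (Cons b \<alpha>)
  then have \<alpha>: "\<alpha> \<in> multi_indices" "b \<in> Basis" by auto
  have "partial_deriv b (convolve X (partial_derivs \<alpha> \<psi>)) = convolve X (partial_derivs (b # \<alpha>) \<psi>)"
    unfolding partial_derivs_Cons
    by (intro ext partial_derivI has_derivative_convolve[where R=R] assms C_infinity_partial_derivs \<alpha>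
        partial_derivs_supp_in)
  with Cons \<alpha> show ?case by (simp add: partial_derivs_Cons)
qed simp

text \<open>A derivative of the convolution is the convolution with the derivative of the kernel, so
  the induction on the order runs over all kernels with support in the same ball.\<close>

lemma C_infinity_convolve:
  fixes X \<psi> :: "'a::euclidean_space \<Rightarrow> real"
  assumes X: "continuous_on UNIV X" and "C_infinity \<psi>" "supp_in R \<psi>"
  shows "C_infinity (convolve X \<psi>)"
  unfolding C_infinity_def
proof
  fix k from assms(2,3) show "C_k k (convolve X \<psi>)"
  proof (induction k arbitrary: \<psi>)
    case 0
    then show ?case using X by (auto intro: continuous_on_convolve C_infinityD)
  next
    case (Suc k)
    have D: "((\<lambda>s. convolve X \<psi> (x + s *\<^sub>R b)) has_field_derivative
        convolve X (partial_deriv b \<psi>) x) (at 0)" if "b \<in> Basis" for b x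
      using that Suc.prems X by (intro has_derivative_convolve)
    have "partial_deriv b (convolve X \<psi>) = convolve X (partial_deriv b \<psi>)" if "b \<in> Basis" for b
      by (intro ext partial_derivI D that)
    moreover have "has_partials (convolve X \<psi>)"
      using D by (rule has_partialsI)
    ultimately show ?case using Suc X
      by (auto intro: continuous_on_convolve C_infinityD partial_deriv_supp_in)
  qed
qed

text \<open>The bound on the kernel is multiplied by the volume of the ball and by a bound of
  \<open>X\<close> on the compact set of all \<open>x - y\<close>; both are independent of
  \<epsilon>.\<close>

lemma moderate_on_convolve:
  fixes X :: "'a::euclidean_space \<Rightarrow> real"
  assumes X: "continuous_on UNIV X" and K: "compact K"
    and \<psi>: "\<And>\<epsilon>. \<epsilon> \<in> {0<..1} \<Longrightarrow> continuous_on UNIV (\<psi> \<epsilon>)" "\<And>\<epsilon>. \<epsilon> \<in> {0<..1} \<Longrightarrow> supp_in R (\<psi> \<epsilon>)"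
    and mod: "moderate_on (cball 0 R) \<psi>"
  shows "moderate_on K (\<lambda>\<epsilon>. convolve X (\<psi> \<epsilon>))"
proof -
  obtain a c where ac: "a \<ge> 0" "c \<ge> 0"
    "\<forall>\<^sub>F \<epsilon> in at_right 0. \<forall>x\<in>cball 0 R. \<bar>\<psi> \<epsilon> x\<bar> \<le> c * \<epsilon> powr (-a)"
    using mod unfolding moderate_on_def by blast
  have "bdd_above ((\<lambda>z. \<bar>X (fst z - snd z)\<bar>) ` (K \<times> cball 0 R))"
    using K by (intro bdd_above_abs_compact compact_Times continuous_on_compose2[OF X] continuous_intros) auto
  then obtain B0 where B0: "\<And>x y. x \<in> K \<Longrightarrow> y \<in> cball 0 R \<Longrightarrow> \<bar>X (x - y)\<bar> \<le> B0"
    by (force simp: bdd_above_def)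
  define B where "B = max B0 0"
  have B: "B \<ge> 0" "\<And>x y. x \<in> K \<Longrightarrow> y \<in> cball 0 R \<Longrightarrow> \<bar>X (x - y)\<bar> \<le> B"
    using B0 unfolding B_def by (auto intro: max.coboundedI1)
  let ?V = "measure lborel (cball (0::'a) R)"
  have "\<forall>\<^sub>F \<epsilon> in at_right 0. \<forall>x\<in>K. \<bar>convolve X (\<psi> \<epsilon>) x\<bar> \<le> (B * c * ?V) * \<epsilon> powr (-a)"
    using ac(3) eventually_unit_interval
  proof eventually_elim
    case (elim \<epsilon>)
    show ?case
    proof
      fix x assume x: "x \<in> K"
      let ?h = "\<lambda>y. X (x - y) * \<psi> \<epsilon> y"
      obtain p q where pq: "cball (0::'a) R \<subseteq> cbox p q" by (rule cball_subset_cbox)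
      have supp: "?h y = 0" if "y \<notin> cball 0 R" for y
        using \<psi>(2)[OF elim(2)] that by (auto simp: supp_in_def)
      have cont: "continuous_on UNIV ?h"
        using \<psi>(1)[OF elim(2)] by (intro continuous_intros continuous_on_compose2[OF X]) auto
      have int: "integrable lborel ?h"
        using supp pq by (intro integral_lborel_cbox(1)[OF cont, of p q]) blast
      have bnd: "\<bar>?h y\<bar> \<le> (B * (c * \<epsilon> powr (-a))) * indicator (cball 0 R) y" for y
      proof (cases "y \<in> cball 0 R")
        case True
        then show ?thesis using elim(1) B x unfolding abs_mult
          by (auto intro!: mult_mono)
      qed (use supp in auto)
      have "\<bar>convolve X (\<psi> \<epsilon>) x\<bar> \<le> (\<integral>y. \<bar>?h y\<bar> \<partial>lborel)"
        unfolding convolve_def by (rule integral_abs_bound)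
      also have "\<dots> \<le> (\<integral>y. (B * (c * \<epsilon> powr (-a))) * indicator (cball (0::'a) R) y \<partial>lborel)"
      proof (rule Bochner_Integration.integral_mono)
        show "integrable lborel (\<lambda>y. (B * (c * \<epsilon> powr (-a))) * indicator (cball (0::'a) R) y)"
          by (intro integrable_mult_right integrable_real_indicator)
            (use emeasure_lborel_cball_finite in \<open>auto simp: less_top\<close>)
      qed (use bnd int in auto)
      also have "\<dots> = (B * c * ?V) * \<epsilon> powr (-a)" by simp
      finally show "\<bar>convolve X (\<psi> \<epsilon>) x\<bar> \<le> (B * c * ?V) * \<epsilon> powr (-a)" .
    qed
  qed
  then show ?thesis unfolding moderate_on_def using ac B(1)
    by (intro exI[of _ a] conjI exI[of _ "B * c * ?V"]) auto
qed

lemma E_M_convolve: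
  fixes X :: "'a::euclidean_space \<Rightarrow> real"
  assumes X: "continuous_on UNIV X" and \<psi>: "\<psi> \<in> E_M" "\<And>\<epsilon>. \<epsilon> \<in> {0<..1} \<Longrightarrow> supp_in R (\<psi> \<epsilon>)"
  shows "(\<lambda>\<epsilon>. convolve X (\<psi> \<epsilon>)) \<in> E_M"
  unfolding E_M_iff
proof (intro conjI allI ballI impI)
  have C: "C_infinity (\<psi> \<epsilon>)" if "\<epsilon> \<in> {0<..1}" for \<epsilon> using \<psi>(1) that by (simp add: E_M_iff)
  then show "C_infinity (convolve X (\<psi> \<epsilon>))" if "\<epsilon> \<in> {0<..1}" for \<epsilon>
    using that X \<psi>(2) by (intro C_infinity_convolve)
  fix K :: "'a set" and \<alpha> :: "'a list" assume K: "compact K" "\<alpha> \<in> multi_indices"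
  have "moderate_on (cball 0 R) (\<lambda>\<epsilon>. partial_derivs \<alpha> (\<psi> \<epsilon>))"
    using \<psi>(1) K(2) by (auto simp: E_M_iff)
  then have "moderate_on K (\<lambda>\<epsilon>. convolve X (partial_derivs \<alpha> (\<psi> \<epsilon>)))"
    using X K C \<psi>(2) by (intro moderate_on_convolve continuous_on_partial_derivs partial_derivs_supp_in)
  then show "moderate_on K (\<lambda>\<epsilon>. partial_derivs \<alpha> (convolve X (\<psi> \<epsilon>)))"
    by (rule moderate_on_cong[rotated]) (use partial_derivs_convolve[OF X C \<psi>(2) K(2)] in simp)
qed

lemma E_M_scaled:
  fixes \<rho> :: "'a::euclidean_space \<Rightarrow> real"
  assumes "schwartz \<rho>"
  shows "(\<lambda>\<epsilon>. scaled \<rho> \<epsilon>) \<in> E_M"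
proof -
  have C: "C_infinity \<rho>" using assms by (simp add: schwartz_def)
  have eq: "scaled \<rho> \<epsilon> = (\<lambda>x. inverse (\<epsilon> ^ DIM('a)) * \<rho> (inverse \<epsilon> *\<^sub>R x))" for \<epsilon>
    by (auto simp: scaled_def field_simps)
  have "moderate_on K (\<lambda>\<epsilon>. partial_derivs \<alpha> (scaled \<rho> \<epsilon>))" if \<alpha>: "\<alpha> \<in> multi_indices" for \<alpha> K
  proof -
    have "bounded (range (\<lambda>x. monomial [] x * partial_derivs \<alpha> \<rho> x))"
      using assms \<alpha> multi_indices_simps(1) unfolding schwartz_def by blast
    then obtain B where B: "\<And>x. \<bar>partial_derivs \<alpha> \<rho> x\<bar> \<le> B"
      unfolding bounded_iff monomial_def by auto
    then have "0 \<le> B" using abs_ge_zero order_trans by blast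
    \<comment> \<open>The normalization contributes the power \<open>DIM('a)\<close>, and each
      derivative one more factor \<open>inverse \<epsilon>\<close>.\<close>
    let ?N = "DIM('a) + length \<alpha>"
    have "\<forall>\<^sub>F \<epsilon> in at_right 0. \<forall>x\<in>K. \<bar>partial_derivs \<alpha> (scaled \<rho> \<epsilon>) x\<bar> \<le> B * \<epsilon> powr (- real ?N)"
      using eventually_unit_interval
    proof eventually_elim
      case (elim \<epsilon>)
      have "\<epsilon> powr (- real ?N) = inverse (\<epsilon> ^ DIM('a)) * inverse \<epsilon> ^ length \<alpha>"
        using elim powr_realpow[of \<epsilon> ?N] by (simp add: powr_minus[of _ "real ?N", simplified] power_add power_inverse)
      then have "\<bar>partial_derivs \<alpha> (scaled \<rho> \<epsilon>) x\<bar> = \<epsilon> powr (- real ?N) * \<bar>partial_derivs \<alpha> \<rho> (inverse \<epsilon> *\<^sub>R x)\<bar>" for x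
        using elim unfolding eq partial_derivs_scale[OF C \<alpha>] by (simp add: abs_mult)
      then show ?case using B by (simp del: of_nat_add) (auto simp: mult.commute[of B] intro!: mult_left_mono)
    qed
    then show ?thesis unfolding moderate_on_def using \<open>0 \<le> B\<close> by (meson of_nat_0_le_iff)
  qed
  then show ?thesis by (auto simp: E_M_iff eq intro: C_infinity_scale C)
qed

subsection \<open>Schwartz mollifiers\<close>

text \<open>An integrable majorant for Schwartz functions in any dimension: the integral factors
  into one-dimensional integrals of \<open>inverse (1 + x\<^sup>2)\<close>.\<close>

lemma integrable_prod_inverse_1_plus_square:
  "integrable lborel (\<lambda>z::'a::euclidean_space. \<Prod>b\<in>Basis. inverse (1 + (z \<bullet> b)\<^sup>2))"
proof -
  have "integrable lborel (\<lambda>x::real. inverse (1 + x\<^sup>2))"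
    using integrable_inverse_1_plus_square by (simp add: set_integrable_def)
  then have "(\<integral>\<^sup>+x. ennreal (inverse (1 + x\<^sup>2)) \<partial>lborel) < \<infinity>"
    by (simp add: integrable_iff_bounded)
  then have "(\<Prod>b\<in>(Basis::'a set). (\<integral>\<^sup>+x. ennreal (inverse (1 + x\<^sup>2)) \<partial>lborel)) < \<infinity>"
    by (simp add: power_less_top_ennreal)
  then have "(\<integral>\<^sup>+z. (\<Prod>b\<in>Basis. ennreal (inverse (1 + (z \<bullet> b)\<^sup>2))) \<partial>(lborel :: 'a measure)) < \<infinity>"
    by (subst nn_integral_lborel_prod) auto
  then show ?thesis
    by (intro integrableI_nonneg AE_I2 prod_nonneg) (auto simp: prod_ennreal)
qed

lemma monomial_Nil [simp]: "monomial [] x = 1"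
  and monomial_Cons [simp]: "monomial (b # \<alpha>) x = (x \<bullet> b) * monomial \<alpha> x"
  by (simp_all add: monomial_def)

lemma continuous_on_monomial: "continuous_on S (monomial \<alpha>)"
proof (induction \<alpha>)
  case (Cons b \<alpha>)
  have "monomial (b # \<alpha>) = (\<lambda>x. (x \<bullet> b) * monomial \<alpha> x)" by auto
  then show ?case using Cons by (auto intro!: continuous_intros)
qed (simp add: monomial_def)

text \<open>Multiplying out one factor \<open>1 + (z \<bullet> b)\<^sup>2\<close> gives one term
  with the monomial \<alpha> and one with \<open>b # b # \<alpha>\<close>. The claim for all
  monomials therefore passes from \<open>bs\<close> to \<open>b # bs\<close>.\<close>

lemma schwartz_decay:
  assumes \<rho>: "schwartz \<rho>" and "set bs \<subseteq> Basis" "\<alpha> \<in> multi_indices"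
  shows "\<exists>B. \<forall>z. \<bar>monomial \<alpha> z * \<rho> z * (\<Prod>b\<leftarrow>bs. 1 + (z \<bullet> b)\<^sup>2)\<bar> \<le> B"
  using assms(2,3)
proof (induction bs arbitrary: \<alpha>)
  case Nil
  then have "bounded (range (\<lambda>x. monomial \<alpha> x * partial_derivs [] \<rho> x))"
    using \<rho> multi_indices_simps(1) unfolding schwartz_def by blast
  then show ?case by (auto simp: bounded_iff)
next
  case (Cons b bs)
  let ?Q = "\<lambda>z. (\<Prod>b\<leftarrow>bs. 1 + (z \<bullet> b)\<^sup>2)"
  have "set bs \<subseteq> Basis" "b # b # \<alpha> \<in> multi_indices" using Cons.prems by auto
  then obtain B1 B2 where B: "\<And>z. \<bar>monomial \<alpha> z * \<rho> z * ?Q z\<bar> \<le> B1"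
      "\<And>z. \<bar>monomial (b # b # \<alpha>) z * \<rho> z * ?Q z\<bar> \<le> B2"
    using Cons.IH Cons.prems(2) by meson
  have "\<bar>monomial \<alpha> z * \<rho> z * (\<Prod>b\<leftarrow>b # bs. 1 + (z \<bullet> b)\<^sup>2)\<bar> \<le> B1 + B2" for z
  proof -
    have "monomial \<alpha> z * \<rho> z * (\<Prod>b\<leftarrow>b # bs. 1 + (z \<bullet> b)\<^sup>2) =
        monomial \<alpha> z * \<rho> z * ?Q z + monomial (b # b # \<alpha>) z * \<rho> z * ?Q z"
      by (simp add: algebra_simps power2_eq_square)
    then show ?thesis using B[of z] abs_triangle_ineq[of "monomial \<alpha> z * \<rho> z * ?Q z"] by simp
  qed
  then show ?case by blast
qed

lemma integrable_monomial_schwartz: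
  fixes \<rho> :: "'a::euclidean_space \<Rightarrow> real"
  assumes \<rho>: "schwartz \<rho>" and \<alpha>: "\<alpha> \<in> multi_indices"
  shows "integrable lborel (\<lambda>z. monomial \<alpha> z * \<rho> z)"
proof -
  obtain bs :: "'a list" where bs: "set bs = Basis" "distinct bs"
    using finite_distinct_list[OF finite_Basis] by blast
  let ?Q = "\<lambda>z::'a. (\<Prod>b\<in>Basis. 1 + (z \<bullet> b)\<^sup>2)"
  have "(\<Prod>b\<leftarrow>bs. 1 + (z \<bullet> b)\<^sup>2) = ?Q z" for z
    using prod.distinct_set_conv_list[OF bs(2), of "\<lambda>b. 1 + (z \<bullet> b)\<^sup>2"] bs(1) by simp
  then obtain B where B: "\<And>z. \<bar>monomial \<alpha> z * \<rho> z * ?Q z\<bar> \<le> B"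
    using schwartz_decay[OF \<rho> _ \<alpha>, of bs] bs(1) by auto
  show ?thesis
  proof (rule Bochner_Integration.integrable_bound)
    show "integrable lborel (\<lambda>z::'a. B * (\<Prod>b\<in>Basis. inverse (1 + (z \<bullet> b)\<^sup>2)))"
      using integrable_prod_inverse_1_plus_square by (rule integrable_mult_right)
    have "continuous_on UNIV (\<lambda>z. monomial \<alpha> z * \<rho> z)"
      using \<rho> by (intro continuous_intros continuous_on_monomial C_infinity_continuous)
        (simp add: schwartz_def)
    then show "(\<lambda>z. monomial \<alpha> z * \<rho> z) \<in> borel_measurable lborel"
      using borel_measurable_continuous_onI by simp
    show "AE z in lborel. norm (monomial \<alpha> z * \<rho> z) \<le> norm (B * (\<Prod>b\<in>Basis. inverse (1 + (z \<bullet> b)\<^sup>2)))"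
    proof (rule AE_I2)
      fix z :: 'a
      have Q: "?Q z > 0" by (intro prod_pos) (auto intro: add_pos_nonneg)
      have "norm (monomial \<alpha> z * \<rho> z) = \<bar>monomial \<alpha> z * \<rho> z * ?Q z\<bar> * inverse (?Q z)"
        using Q right_inverse[of "?Q z"] by (simp only: abs_mult mult.assoc abs_of_pos real_norm_def)
      also have "\<dots> \<le> B * inverse (?Q z)"
        using B Q by (intro mult_right_mono) auto
      also have "\<dots> = B * (\<Prod>b\<in>Basis. inverse (1 + (z \<bullet> b)\<^sup>2))"
        using prod_inversef[of "\<lambda>b. 1 + (z \<bullet> b)\<^sup>2" Basis] by (simp add: o_def)
      finally show "norm (monomial \<alpha> z * \<rho> z) \<le> norm (B * (\<Prod>b\<in>Basis. inverse (1 + (z \<bullet> b)\<^sup>2)))"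
        by simp
    qed
  qed
qed

text \<open>Total mass and first absolute moment are the two integrals in which the mollification
  error is measured; the moment is dominated by the coordinate moments.\<close>

lemma integrable_schwartz:
  fixes \<rho> :: "'a::euclidean_space \<Rightarrow> real"
  assumes "schwartz \<rho>"
  shows "integrable lborel \<rho>" "integrable lborel (\<lambda>z. norm z * \<bar>\<rho> z\<bar>)"
proof -
  show "integrable lborel \<rho>" using integrable_monomial_schwartz[OF assms, of "[]"] by simp
  have \<rho>: "\<rho> \<in> borel_measurable borel"
    using assms by (intro borel_measurable_continuous_onI C_infinity_continuous) (simp add: schwartz_def)
  have "integrable lborel (\<lambda>z. (z \<bullet> b) * \<rho> z)" if "b \<in> Basis" for b
    using integrable_monomial_schwartz[OF assms, of "[b]"] that by simp
  then have "integrable lborel (\<lambda>z. \<Sum>b\<in>Basis. \<bar>(z \<bullet> b) * \<rho> z\<bar>)"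
    by (intro Bochner_Integration.integrable_sum integrable_abs)
  then show "integrable lborel (\<lambda>z. norm z * \<bar>\<rho> z\<bar>)"
  proof (rule Bochner_Integration.integrable_bound)
    show "AE z in lborel. norm (norm z * \<bar>\<rho> z\<bar>) \<le> norm (\<Sum>b\<in>Basis. \<bar>(z \<bullet> b) * \<rho> z\<bar>)"
      by (auto simp: abs_mult sum_nonneg simp flip: sum_distrib_right intro!: mult_right_mono norm_le_l1)
  qed (use \<rho> in simp)
qed

text \<open>After the substitution \<open>y = \<epsilon> z\<close> the error is the integral of
  \<open>?Y x (\<epsilon> z) * \<rho> z\<close>. As \<rho> has no compact support, \<open>?Y\<close>
  is bounded by a small constant plus a multiple of \<open>norm y\<close>; the first moment of
  \<rho> then turns the second part into a term of order \<epsilon>.\<close>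

lemma convolve_loc_unif:
  fixes X \<rho> \<theta> :: "'a::euclidean_space \<Rightarrow> real"
  assumes X: "continuous_on UNIV X" and \<rho>: "schwartz \<rho>" "(\<integral>x. \<rho> x \<partial>lborel) = 1"
    and \<theta>: "continuous_on UNIV \<theta>" "supp_in R \<theta>" "\<theta> 0 = 1"
  shows "loc_unif (\<lambda>\<epsilon>. convolve X (\<lambda>y. \<theta> y * scaled \<rho> \<epsilon> y)) X"
  unfolding loc_unif_def
proof (intro allI impI uniform_limitI)
  fix K :: "'a set" and e :: real assume K: "compact K" and e: "e > 0"
  note int = integrable_schwartz[OF \<rho>(1)]
  have \<rho>m: "\<rho> \<in> borel_measurable borel"
    using \<rho>(1) by (intro borel_measurable_continuous_onI C_infinity_continuous) (simp add: schwartz_def)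
  define J where "J = (\<integral>z. \<bar>\<rho> z\<bar> \<partial>lborel)"
  define J1 where "J1 = (\<integral>z. norm z * \<bar>\<rho> z\<bar> \<partial>lborel)"
  have J: "J \<ge> 0" "J1 \<ge> 0" unfolding J_def J1_def by (auto intro!: integral_nonneg)
  \<comment> \<open>This choice keeps \<open>h * J\<close> strictly below \<open>e\<close>, which
    leaves room for the term of order \<epsilon>; the summand 1 avoids a division by 0.\<close>
  define h where "h = e / (2 * (J + 1))"
  have h: "h > 0" "h * J < e" using e J by (auto simp: h_def field_simps add_nonneg_pos)
  \<comment> \<open>The radius is at least 1, so that every \<open>y\<close> with
    \<open>norm y < d1\<close> lies in the ball on which uniform continuity is available.\<close>
  define R' where "R' = max R 1"
  let ?Y = "\<lambda>x y. X (x - y) * \<theta> y - X x"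
  let ?S = "K \<times> cball (0::'a) R'"
  have S: "compact ?S" using K by (intro compact_Times) auto
  have contY: "continuous_on ?S (\<lambda>z. ?Y (fst z) (snd z))"
    by (intro continuous_intros continuous_on_compose2[OF X] continuous_on_compose2[OF \<theta>(1)]) auto
  have "bdd_above ((\<lambda>z. \<bar>?Y (fst z) (snd z)\<bar>) ` ?S)" using S contY by (rule bdd_above_abs_compact)
  then obtain B1 where B1: "\<And>x y. x \<in> K \<Longrightarrow> y \<in> cball 0 R' \<Longrightarrow> \<bar>?Y x y\<bar> \<le> B1"
    by (force simp: bdd_above_def)
  have "bdd_above ((\<lambda>x. \<bar>X x\<bar>) ` K)"
    using K X by (intro bdd_above_abs_compact continuous_on_subset[OF X]) auto
  then obtain B2 where B2: "\<And>x. x \<in> K \<Longrightarrow> \<bar>X x\<bar> \<le> B2" by (force simp: bdd_above_def)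
  define B where "B = max 0 (max B1 B2)"
  have B: "\<bar>?Y x y\<bar> \<le> B" if "x \<in> K" for x y
  proof (cases "y \<in> cball 0 R'")
    case False
    then have "\<theta> y = 0" using \<theta>(2) by (auto simp: supp_in_def R'_def)
    then show ?thesis using B2[OF that] by (simp add: B_def)
  qed (use B1 that in \<open>force simp: B_def\<close>)
  have "uniformly_continuous_on ?S (\<lambda>z. ?Y (fst z) (snd z))"
    using contY S by (rule compact_uniformly_continuous)
  then obtain d where d: "d > 0" "\<And>z z'. z \<in> ?S \<Longrightarrow> z' \<in> ?S \<Longrightarrow> dist z' z < d \<Longrightarrow>
      dist (?Y (fst z') (snd z')) (?Y (fst z) (snd z)) < h"
    using h(1) unfolding uniformly_continuous_on_def by metis
  define d1 where "d1 = min d 1"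
  have d1: "d1 > 0" using d(1) by (simp add: d1_def)
  \<comment> \<open>Near 0 uniform continuity gives \<open>h\<close>, because
    \<open>?Y x 0 = 0\<close> by \<open>\<theta> 0 = 1\<close>; from distance \<open>d1\<close> on,
    the global bound \<open>B\<close> is at most \<open>(B / d1) * norm y\<close>.\<close>
  have Y: "\<bar>?Y x y\<bar> \<le> h + (B / d1) * norm y" if x: "x \<in> K" for x y
  proof (cases "norm y < d1")
    case True
    then have "dist (?Y x y) (?Y x 0) < h"
      using d(2)[of "(x, 0)" "(x, y)"] x by (auto simp: dist_Pair_Pair d1_def R'_def)
    then have "\<bar>?Y x y\<bar> < h" using \<theta>(3) by (simp add: dist_real_def)
    moreover have "0 \<le> (B / d1) * norm y" using d1 by (simp add: B_def)
    ultimately show ?thesis by linarith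
  next
    case False
    then have "B * 1 \<le> B * (norm y / d1)" using d1 by (intro mult_left_mono) (auto simp: B_def)
    with B[OF x, of y] h(1) show ?thesis by simp
  qed
  have bound: "\<bar>convolve X (\<lambda>y. \<theta> y * scaled \<rho> \<epsilon> y) x - X x\<bar> \<le> h * J + (B / d1 * J1) * \<epsilon>"
    if x: "x \<in> K" and \<epsilon>: "\<epsilon> > 0" for x \<epsilon>
  proof -
    let ?W = "\<lambda>z. ?Y x (\<epsilon> *\<^sub>R z) * \<rho> z"
    have Wm: "?W \<in> borel_measurable borel"
      by (intro borel_measurable_times \<rho>m borel_measurable_continuous_onI continuous_intros
          continuous_on_compose2[OF X] continuous_on_compose2[OF \<theta>(1)]) auto
    have Wb: "\<bar>?W z\<bar> \<le> h * \<bar>\<rho> z\<bar> + (B / d1 * \<epsilon>) * (norm z * \<bar>\<rho> z\<bar>)" for z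
    proof -
      have "\<bar>?W z\<bar> \<le> (h + (B / d1) * norm (\<epsilon> *\<^sub>R z)) * \<bar>\<rho> z\<bar>"
        unfolding abs_mult by (intro mult_right_mono Y[OF x]) auto
      then show ?thesis using \<epsilon> by (simp add: algebra_simps)
    qed
    have intb: "integrable lborel (\<lambda>z. h * \<bar>\<rho> z\<bar> + (B / d1 * \<epsilon>) * (norm z * \<bar>\<rho> z\<bar>))"
      using int by (intro Bochner_Integration.integrable_add integrable_mult_right integrable_abs)
    have Wi: "integrable lborel ?W"
      using Wb by (intro Bochner_Integration.integrable_bound[OF intb]) (auto simp: Wm intro: order_trans[OF _ abs_ge_self])
    have "convolve X (\<lambda>y. \<theta> y * scaled \<rho> \<epsilon> y) x =
        (\<integral>y. (X (x - y) * \<theta> y * \<rho> (y /\<^sub>R \<epsilon>)) / \<epsilon> ^ DIM('a) \<partial>lborel)"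
      by (simp add: convolve_def scaled_def mult.assoc)
    also have "\<dots> = (\<integral>z. X (x - \<epsilon> *\<^sub>R z) * \<theta> (\<epsilon> *\<^sub>R z) * \<rho> ((\<epsilon> *\<^sub>R z) /\<^sub>R \<epsilon>) \<partial>lborel)"
    proof (rule integral_scale)
      show "(\<lambda>y. X (x - y) * \<theta> y * \<rho> (y /\<^sub>R \<epsilon>)) \<in> borel_measurable borel"
        by (intro borel_measurable_continuous_onI continuous_intros continuous_on_compose2[OF X] \<theta>(1)
            continuous_on_compose2[OF C_infinityD(1), of \<rho>]) (use \<rho>(1) in \<open>auto simp: schwartz_def\<close>)
    qed (use \<epsilon> in auto)
    \<comment> \<open>Adding and subtracting \<open>X x * \<rho> z\<close> separates the limit,
      whose integral is \<open>X x\<close> since \<rho> has mass 1.\<close>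
    also have "\<dots> = (\<integral>z. ?W z + X x * \<rho> z \<partial>lborel)"
      using \<epsilon> by (simp add: algebra_simps)
    also have "\<dots> = (\<integral>z. ?W z \<partial>lborel) + X x"
      using Wi int(1) \<rho>(2) by simp
    finally have "\<bar>convolve X (\<lambda>y. \<theta> y * scaled \<rho> \<epsilon> y) x - X x\<bar> = \<bar>\<integral>z. ?W z \<partial>lborel\<bar>" by simp
    also have "\<dots> \<le> (\<integral>z. \<bar>?W z\<bar> \<partial>lborel)" by (rule integral_abs_bound)
    also have "\<dots> \<le> (\<integral>z. h * \<bar>\<rho> z\<bar> + (B / d1 * \<epsilon>) * (norm z * \<bar>\<rho> z\<bar>) \<partial>lborel)"
      using Wi intb Wb by (intro Bochner_Integration.integral_mono integrable_abs)
    also have "\<dots> = h * J + (B / d1 * J1) * \<epsilon>"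
      using int unfolding J_def J1_def by simp
    finally show ?thesis .
  qed
  have "((\<lambda>\<epsilon>. h * J + (B / d1 * J1) * \<epsilon>) \<longlongrightarrow> h * J + (B / d1 * J1) * 0) (at_right 0)"
    by (intro tendsto_intros)
  then have "\<forall>\<^sub>F \<epsilon> in at_right 0. h * J + (B / d1 * J1) * \<epsilon> < e"
    using h(2) by (intro order_tendstoD(2)) auto
  then show "\<forall>\<^sub>F \<epsilon> in at_right 0. \<forall>x\<in>K. dist (convolve X (\<lambda>y. \<theta> y * scaled \<rho> \<epsilon> y) x) (X x) < e"
    using eventually_unit_interval
  proof eventually_elim
    case (elim \<epsilon>)
    then show ?case using bound by (force simp: dist_real_def)
  qed
qed

subsection \<open>Measurability of pathwise convolutions\<close>

text \<open>Completeness makes every subset of \<open>N\<close> measurable, so arbitrary values on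
  \<open>N\<close> do no harm. This deals with the exceptional paths, along which a convolution has
  no controlled value.\<close>

lemma (in complete_measure) borel_measurable_eq_outside_null:
  fixes f g :: "'a \<Rightarrow> real"
  assumes g: "g \<in> borel_measurable M" and N: "N \<in> null_sets M"
    and eq: "\<And>\<omega>. \<omega> \<in> space M - N \<Longrightarrow> f \<omega> = g \<omega>"
  shows "f \<in> borel_measurable M"
proof (rule measurableI)
  fix A :: "real set" assume A: "A \<in> sets borel"
  have "f -` A \<inter> space M = (g -` A \<inter> space M - N) \<union> (f -` A \<inter> space M \<inter> N)"
    using eq by auto
  moreover have "g -` A \<inter> space M - N \<in> sets M"
    using measurable_sets[OF g A] N by auto
  moreover have "f -` A \<inter> space M \<inter> N \<in> sets M"
    by (rule complete[OF _ N]) auto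
  ultimately show "f -` A \<inter> space M \<in> sets M" by (metis sets.Un)
qed auto

text \<open>Joint measurability comes from replacing the space variable by simple functions converging to it.\<close>

lemma borel_measurable_random_field_pair:
  fixes X :: "'a::euclidean_space \<Rightarrow> 'w \<Rightarrow> real"
  assumes X [measurable]: "\<And>y. X y \<in> borel_measurable M"
    and cont: "\<And>\<omega>. \<omega> \<in> space M \<Longrightarrow> continuous_on UNIV (\<lambda>y. X y \<omega>)"
  shows "(\<lambda>z. X (snd z) (fst z)) \<in> borel_measurable (M \<Otimes>\<^sub>M borel)"
proof -
  have "(\<lambda>y::'a. y) \<in> borel_measurable borel" by simp
  from borel_measurable_implies_sequence_metric[OF this, of 0] obtain F :: "nat \<Rightarrow> 'a \<Rightarrow> 'a"
    where F: "\<And>i. simple_function borel (F i)" "\<And>y. (\<lambda>i. F i y) \<longlonglongrightarrow> y" by auto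
  show ?thesis
  proof (rule borel_measurable_LIMSEQ_real)
    fix z :: "'w \<times> 'a" assume "z \<in> space (M \<Otimes>\<^sub>M borel)"
    then have "fst z \<in> space M" by (auto simp: space_pair_measure)
    then have "isCont (\<lambda>y. X y (fst z)) (snd z)"
      using cont by (simp add: continuous_on_eq_continuous_at)
    then show "(\<lambda>i. X (F i (snd z)) (fst z)) \<longlonglongrightarrow> X (snd z) (fst z)"
      using F(2) by (rule isCont_tendsto_compose)
  next
    fix i
    show "(\<lambda>z. X (F i (snd z)) (fst z)) \<in> borel_measurable (M \<Otimes>\<^sub>M borel)"
    \<comment> \<open>\<open>F i\<close> takes finitely many values, and for each fixed value
      \<open>y\<close> the map \<open>X y\<close> is measurable.\<close>
    proof (rule measurable_compose_countable'[where I = "range (F i)" and f = "\<lambda>y z. X y (fst z)"])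
      have "F i \<in> measurable borel (count_space (range (F i)))"
        using measurable_simple_function[OF F(1), of i] simple_functionD(1)[OF F(1), of i]
        by (subst measurable_count_space_eq2)
          (auto dest: measurable_sets[of "F i" borel "count_space UNIV"])
      then show "(\<lambda>z. F i (snd z)) \<in> measurable (M \<Otimes>\<^sub>M borel) (count_space (range (F i)))"
        by measurable
      show "countable (range (F i))"
        using simple_functionD(1)[OF F(1), of i] by (auto intro: countable_finite)
    qed simp
  qed
qed

text \<open>A random field is measurable in \<omega> for each fixed point only. Continuity of the
  paths makes it jointly measurable, and then the integral over \<open>y\<close> is measurable in
  \<omega>.\<close>

lemma borel_measurable_convolve:
  fixes X :: "'a::euclidean_space \<Rightarrow> 'w \<Rightarrow> real"
  assumes "complete_measure M" and X: "\<And>y. X y \<in> borel_measurable M"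
    and cont: "AE \<omega> in M. continuous_on UNIV (\<lambda>y. X y \<omega>)"
    and \<psi> [measurable]: "\<psi> \<in> borel_measurable borel"
  shows "(\<lambda>\<omega>. convolve (\<lambda>y. X y \<omega>) \<psi> x) \<in> borel_measurable M"
proof -
  interpret complete_measure M by fact
  obtain N where N: "{\<omega> \<in> space M. \<not> continuous_on UNIV (\<lambda>y. X y \<omega>)} \<subseteq> N" "N \<in> null_sets M"
    using cont by (auto elim!: AE_E simp: null_sets_def)
  \<comment> \<open>Replacing the exceptional paths by 0 makes every path continuous, as joint
    measurability requires.\<close>
  define Z where "Z y \<omega> = (if \<omega> \<in> N then 0 else X y \<omega>)" for y \<omega>
  have [measurable]: "N \<in> sets M" using N(2) by auto
  have "Z y \<in> borel_measurable M" for y unfolding Z_def using X[of y] by measurable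
  moreover have "continuous_on UNIV (\<lambda>y. Z y \<omega>)" if "\<omega> \<in> space M" for \<omega>
    using N(1) that by (cases "\<omega> \<in> N") (auto simp: Z_def)
  ultimately have Z: "(\<lambda>z. Z (snd z) (fst z)) \<in> borel_measurable (M \<Otimes>\<^sub>M borel)"
    by (rule borel_measurable_random_field_pair)
  have "(\<lambda>z. (fst z, x - snd z)) \<in> measurable (M \<Otimes>\<^sub>M borel) (M \<Otimes>\<^sub>M (borel :: 'a measure))" by measurable
  from measurable_compose[OF this Z]
  have "(\<lambda>(\<omega>, y). Z (x - y) \<omega> * \<psi> y) \<in> borel_measurable (M \<Otimes>\<^sub>M borel)"
    by (auto simp: split_beta intro!: borel_measurable_times)
  then have "(\<lambda>(\<omega>, y). Z (x - y) \<omega> * \<psi> y) \<in> borel_measurable (M \<Otimes>\<^sub>M lborel)"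
    by (simp cong: measurable_cong_sets sets_pair_measure_cong)
  then have "(\<lambda>\<omega>. convolve (\<lambda>y. Z y \<omega>) \<psi> x) \<in> borel_measurable M"
    unfolding convolve_def by (rule lborel.borel_measurable_lebesgue_integral)
  then show ?thesis
    by (rule borel_measurable_eq_outside_null[OF _ N(2)]) (simp add: Z_def)
qed

subsection \<open>A barrier estimate for transport systems\<close>

text \<open>The bound on \<open>h\<close> is only needed at points where all components are controlled by the same \<open>m\<close>, which is
  what a first contact with the barrier provides.\<close>

lemma barrier_bound:
  fixes w :: "'n::finite \<Rightarrow> real \<times> real \<Rightarrow> real"
  assumes cont: "\<And>i. continuous_on UNIV (w i)"
    and C: "0 \<le> C" and \<eta>: "0 < \<eta>" "\<delta> \<le> \<eta>" and A: "0 \<le> A"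
    and deriv: "\<And>i x t. 0 < t \<Longrightarrow> t \<le> T \<Longrightarrow> \<bar>x\<bar> \<le> R + C * (T - t) \<Longrightarrow>
      \<exists>c h. \<bar>c\<bar> \<le> C \<and> ((\<lambda>s. w i (x - s * c, t - s)) has_real_derivative - h) (at 0) \<and>
        (\<forall>m. (\<forall>j. \<bar>w j (x, t)\<bar> \<le> m) \<longrightarrow> \<bar>h\<bar> \<le> A * m + \<delta>)"
    and init: "\<And>i x. \<bar>x\<bar> \<le> R + C * T \<Longrightarrow> \<bar>w i (x, 0)\<bar> < \<eta>"
    and t: "0 \<le> t" "t \<le> T" and x: "\<bar>x\<bar> \<le> R + C * (T - t)"
  shows "\<bar>w i (x, t)\<bar> < \<eta> * exp ((A + 2) * t)"
proof (rule ccontr)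
  assume neg: "\<not> \<bar>w i (x, t)\<bar> < \<eta> * exp ((A + 2) * t)"
  define b where "b t = \<eta> * exp ((A + 2) * t)" for t
  \<comment> \<open>The trapezoid: its cross section grows with slope \<open>C\<close> as time
    decreases, so it is never left by going backward with a speed of at most
    \<open>C\<close>.\<close>
  define D where "D = {z. 0 \<le> snd z \<and> snd z \<le> T \<and> \<bar>fst z\<bar> \<le> R + C * (T - snd z)}"
  \<comment> \<open>All contacts of some component with the barrier; the claim is that there are
    none. Compactness yields one of minimal time.\<close>
  define S where "S = (\<Union>j. D \<inter> {z. b (snd z) \<le> \<bar>w j z\<bar>})"
  have "closed D" unfolding D_def
    by (intro closed_Collect_conj closed_Collect_le continuous_intros)
  moreover have "D \<subseteq> cbox (- (R + C * T), 0) (R + C * T, T)"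
  proof
    fix z assume "z \<in> D"
    moreover from this have "C * (T - snd z) \<le> C * T" using C by (auto simp: D_def intro: mult_left_mono)
    ultimately show "z \<in> cbox (- (R + C * T), 0) (R + C * T, T)"
      by (cases z) (auto simp: D_def cbox_Pair_eq)
  qed
  then have "bounded D" by (rule bounded_subset[OF bounded_cbox])
  ultimately have "compact D" by (simp add: compact_eq_bounded_closed)
  moreover have "closed {z. b (snd z) \<le> \<bar>w j z\<bar>}" for j
    unfolding b_def by (intro closed_Collect_le continuous_intros cont)
  ultimately have "compact (D \<inter> {z. b (snd z) \<le> \<bar>w j z\<bar>})" for j
    by (rule compact_Int_closed)
  then have "compact S" unfolding S_def by (intro compact_UN) auto
  moreover have "(x, t) \<in> S" using neg t x by (auto simp: S_def D_def b_def not_less)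
  ultimately have "\<exists>z\<in>S. \<forall>y\<in>S. snd z \<le> snd y"
    by (intro continuous_attains_inf continuous_intros) auto
  then obtain z where z: "z \<in> S" "\<And>y. y \<in> S \<Longrightarrow> snd z \<le> snd y" by blast
  obtain x0 t0 where z_eq: "z = (x0, t0)" by (cases z)
  obtain k where D0: "0 \<le> t0" "t0 \<le> T" "\<bar>x0\<bar> \<le> R + C * (T - t0)" and k: "b t0 \<le> \<bar>w k (x0, t0)\<bar>"
    using z(1) by (auto simp: S_def D_def z_eq)
  have before: "\<bar>w j (y, s)\<bar> < b s" if "0 \<le> s" "s < t0" "\<bar>y\<bar> \<le> R + C * (T - s)" for j y s
  proof (rule ccontr)
    assume "\<not> ?thesis"
    then have "(y, s) \<in> S" using that D0 by (auto simp: S_def D_def not_less)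
    then show False using z(2)[of "(y, s)"] that by (simp add: z_eq)
  qed
  have bpos: "b s > 0" for s using \<eta> by (simp add: b_def)
  have "t0 \<noteq> 0" using init[of x0 k] D0 k by (auto simp: b_def)
  then have t0: "t0 > 0" using D0 by simp
  \<comment> \<open>Before \<open>t0\<close> all components lie below the barrier, and
    \<open>(x0, s)\<close> belongs to the trapezoid for earlier \<open>s\<close>; letting
    \<open>s\<close> increase to \<open>t0\<close> gives the bound for every component. It is the
    common bound \<open>m\<close> that the hypothesis on \<open>h\<close> asks for.\<close>
  have bnd: "\<bar>w j (x0, t0)\<bar> \<le> b t0" for j
  proof (rule tendsto_le)
    have c: "isCont (w j) (x0, t0)" using cont by (simp add: continuous_on_eq_continuous_at)
    have "((\<lambda>s. (x0, s)) \<longlongrightarrow> (x0, t0)) (at_left t0)" by (intro tendsto_intros)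
    from isCont_tendsto_compose[OF c this]
    show "((\<lambda>s. \<bar>w j (x0, s)\<bar>) \<longlongrightarrow> \<bar>w j (x0, t0)\<bar>) (at_left t0)"
      by (intro tendsto_intros)
    show "(b \<longlongrightarrow> b t0) (at_left t0)"
      unfolding b_def by (intro tendsto_intros)
    have "\<forall>\<^sub>F s in at_left t0. s \<in> {0<..<t0}" using t0 by (rule eventually_at_left_real)
    then show "\<forall>\<^sub>F s in at_left t0. \<bar>w j (x0, s)\<bar> \<le> b s"
    proof eventually_elim
      case (elim s)
      have "C * (T - t0) \<le> C * (T - s)" using elim C by (intro mult_left_mono) auto
      then show ?case using before[of s x0 j] elim D0 by auto
    qed
  qed simp
  obtain c h where c: "\<bar>c\<bar> \<le> C" and
    h: "((\<lambda>s. w k (x0 - s * c, t0 - s)) has_real_derivative - h) (at 0)" "\<bar>h\<bar> \<le> A * b t0 + \<delta>"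
    using deriv[OF t0 D0(2,3), of k] bnd by blast
  have bd: "((\<lambda>s. b (t0 - s)) has_real_derivative - ((A + 2) * b t0)) (at 0)"
    unfolding b_def by (auto intro!: derivative_eq_intros simp: algebra_simps)
  define \<sigma> where "\<sigma> = sgn (w k (x0, t0))"
  have \<sigma>: "\<sigma> * w k (x0, t0) = b t0" "\<bar>\<sigma>\<bar> = 1"
    using bnd[of k] k bpos[of t0] by (auto simp: \<sigma>_def sgn_if)
  \<comment> \<open>The gap between barrier and signed component along the backward segment. It is 0
    at the contact, and a negative slope would make it negative just before, against the minimality
    of \<open>t0\<close>.\<close>
  let ?\<phi> = "\<lambda>s. b (t0 - s) - \<sigma> * w k (x0 - s * c, t0 - s)"
  have "(?\<phi> has_real_derivative (- ((A + 2) * b t0) - \<sigma> * (- h))) (at 0)"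
    by (intro DERIV_diff bd DERIV_cmult h)
  \<comment> \<open>Here the rate \<open>A + 2\<close> is spent: \<open>A * b t0\<close> pays for
    the coupling, one further \<open>b t0\<close> for \<delta>, because
    \<open>\<delta> \<le> \<eta> \<le> b t0\<close>, and the last one makes the sign strict.\<close>
  moreover have "- ((A + 2) * b t0) - \<sigma> * (- h) < 0"
  proof -
    have "\<sigma> * h \<le> \<bar>h\<bar>" using \<sigma>(2) abs_ge_self[of "\<sigma> * h"] by (simp add: abs_mult)
    moreover have "1 * \<eta> \<le> b t0" unfolding b_def
      using t0 A \<eta> by (subst mult.commute) (auto intro!: mult_left_mono)
    ultimately show ?thesis using h(2) \<eta> bpos[of t0] by (simp add: algebra_simps)
  qed
  ultimately obtain d where d: "d > 0" "\<And>s. s > 0 \<Longrightarrow> s < d \<Longrightarrow> ?\<phi> (0 + s) < ?\<phi> 0"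
    using DERIV_neg_dec_right[of ?\<phi>] by blast
  define s where "s = min d t0 / 2"
  have s: "0 < s" "s < d" "s < t0" using d(1) t0 by (auto simp: s_def)
  \<comment> \<open>In backward time \<open>s\<close> the segment moves by at most
    \<open>s * C\<close>, exactly the amount by which the cross section of the trapezoid
    grows.\<close>
  have "\<bar>x0 - s * c\<bar> \<le> \<bar>x0\<bar> + s * \<bar>c\<bar>"
    using abs_triangle_ineq4[of x0 "s * c"] s(1) by (simp add: abs_mult)
  also have "\<dots> \<le> R + C * (T - t0) + s * C"
    using D0(3) c s(1) by (intro add_mono mult_left_mono) auto
  finally have "\<bar>w k (x0 - s * c, t0 - s)\<bar> < b (t0 - s)"
    using s by (intro before) (auto simp: algebra_simps)
  moreover have "\<sigma> * w k (x0 - s * c, t0 - s) \<le> \<bar>w k (x0 - s * c, t0 - s)\<bar>"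
    using \<sigma>(2) abs_ge_self[of "\<sigma> * w k (x0 - s * c, t0 - s)"] by (simp add: abs_mult)
  ultimately have "?\<phi> s > 0" by linarith
  moreover have "?\<phi> s < 0" using d(2)[OF s(1,2)] \<sigma>(1) by simp
  ultimately show False by simp
qed

text \<open>\<open>C_k 1\<close> provides derivatives along the axes, whereas the barrier argument
  differentiates in an oblique direction. Continuity of the time derivative upgrades the partial
  derivatives to a total one.\<close>

lemma C1_has_derivative:
  fixes f :: "real \<times> real \<Rightarrow> real"
  assumes "C_k 1 f"
  shows "(f has_derivative (\<lambda>h. partial_deriv (1, 0) f z * fst h + partial_deriv (0, 1) f z * snd h)) (at z)"
proof -
  obtain x t where z: "z = (x, t)" by (cases z)
  have f: "has_partials f" "continuous_on UNIV (partial_deriv (0, 1) f)"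
    using assms by (auto simp: Basis_prod_def)
  have "((\<lambda>(x, t). f (x, t)) has_derivative (\<lambda>(hx, ht). partial_deriv (1, 0) f (x, t) * hx +
      blinfun_apply (partial_deriv (0, 1) f (x, t) *\<^sub>R id_blinfun) ht)) (at (x, t) within UNIV \<times> UNIV)"
  proof (rule has_derivative_partialsI)
    have "((\<lambda>s. f ((0, t) + s *\<^sub>R (1, 0))) has_field_derivative partial_deriv (1, 0) f ((0, t) + x *\<^sub>R (1, 0))) (at x)"
      using f by (intro has_partialsD) (auto simp: Basis_prod_def)
    then show "((\<lambda>x. f (x, t)) has_derivative (*) (partial_deriv (1, 0) f (x, t))) (at x within UNIV)"
      by (simp add: has_field_derivative_def)
    fix x t
    have "((\<lambda>s. f ((x, 0) + s *\<^sub>R (0, 1))) has_field_derivative partial_deriv (0, 1) f ((x, 0) + t *\<^sub>R (0, 1))) (at t)"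
      using f by (intro has_partialsD) (auto simp: Basis_prod_def)
    then show "((\<lambda>t. f (x, t)) has_derivative
        blinfun_apply (partial_deriv (0, 1) f (x, t) *\<^sub>R id_blinfun)) (at t within UNIV)"
      by (simp add: has_field_derivative_def scaleR_blinfun.rep_eq id_blinfun.rep_eq)
  next
    have "continuous (at (x, t)) (\<lambda>z. partial_deriv (0, 1) f z *\<^sub>R (id_blinfun :: real \<Rightarrow>\<^sub>L real))"
      using f(2) by (intro continuous_intros) (simp add: continuous_on_eq_continuous_at)
    then show "continuous (at (x, t) within UNIV \<times> UNIV)
        (\<lambda>(x, t). partial_deriv (0, 1) f (x, t) *\<^sub>R (id_blinfun :: real \<Rightarrow>\<^sub>L real))"
      by (simp add: case_prod_unfold)
  qed auto
  then show ?thesis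
    by (simp add: z case_prod_unfold scaleR_blinfun.rep_eq id_blinfun.rep_eq)
qed

text \<open>For \<open>c = \<sigma> * l\<close> the derivative is \<open>- \<sigma>\<close> times
  the transport operator with speed \<open>l\<close>, so the equation can be inserted in either time
  direction.\<close>

lemma C1_has_derivative_line:
  fixes f :: "real \<times> real \<Rightarrow> real"
  assumes "C_k 1 f"
  shows "((\<lambda>s. f (x - s * c, \<sigma> * (t - s))) has_real_derivative
    - (\<sigma> * partial_deriv (0, 1) f (x, \<sigma> * t) + c * partial_deriv (1, 0) f (x, \<sigma> * t))) (at 0)"
proof -
  have line: "((\<lambda>s. (x - s * c, \<sigma> * (t - s))) has_derivative (\<lambda>h. (- (h * c), - (\<sigma> * h)))) (at 0)"
    by (auto intro!: derivative_eq_intros)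
  have "((\<lambda>s. f (x - s * c, \<sigma> * (t - s))) has_derivative
      (\<lambda>h. partial_deriv (1, 0) f (x, \<sigma> * t) * - (h * c) + partial_deriv (0, 1) f (x, \<sigma> * t) * - (\<sigma> * h))) (at 0)"
    using has_derivative_compose[OF line, of f] C1_has_derivative[OF assms, of "(x, \<sigma> * t)"] by fastforce
  then show ?thesis
    unfolding has_field_derivative_def by (rule has_derivative_eq_rhs) (simp add: fun_eq_iff algebra_simps)
qed

section \<open>Calculus of locally uniform limits\<close>

lemma loc_unif_add: "loc_unif u a \<Longrightarrow> loc_unif v b \<Longrightarrow> loc_unif (\<lambda>\<epsilon> x. u \<epsilon> x + v \<epsilon> x) (\<lambda>x. a x + b x)"
  and loc_unif_diff: "loc_unif u a \<Longrightarrow> loc_unif v b \<Longrightarrow> loc_unif (\<lambda>\<epsilon> x. u \<epsilon> x - v \<epsilon> x) (\<lambda>x. a x - b x)"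
  and loc_unif_const: "loc_unif (\<lambda>\<epsilon>. a) a"
  by (auto simp: loc_unif_def intro!: uniform_limit_intros)

lemma loc_unif_sum:
  "(\<And>j. j \<in> J \<Longrightarrow> loc_unif (u j) (a j)) \<Longrightarrow> loc_unif (\<lambda>\<epsilon> x. \<Sum>j\<in>J. u j \<epsilon> x) (\<lambda>x. \<Sum>j\<in>J. a j x)"
  by (induction J rule: infinite_finite_induct) (auto intro!: loc_unif_add loc_unif_const)

text \<open>Products of uniform limits need bounded limits; continuity of the limits supplies this
  on compact sets.\<close>

lemma loc_unif_mult:
  assumes "loc_unif u a" "loc_unif v b" "continuous_on UNIV a" "continuous_on UNIV b"
  shows "loc_unif (\<lambda>\<epsilon> x. u \<epsilon> x * v \<epsilon> x) (\<lambda>x. a x * b x)"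
  unfolding loc_unif_def
proof (intro allI impI uniform_lim_mult)
  fix K :: "'a set" assume K: "compact K"
  then show "bounded (a ` K)" "bounded (b ` K)"
    using assms by (auto intro!: compact_imp_bounded compact_continuous_image intro: continuous_on_subset)
qed (use assms in \<open>auto simp: loc_unif_def\<close>)

lemma loc_unif_cong:
  assumes "loc_unif u a" "\<And>\<epsilon> x. \<epsilon> \<in> {0<..1} \<Longrightarrow> v \<epsilon> x = u \<epsilon> x"
  shows "loc_unif v a"
  unfolding loc_unif_def
proof (intro allI impI)
  fix K :: "'a set" assume "compact K"
  with assms(1) have "uniform_limit K u a (at_right 0)" by (simp add: loc_unif_def)
  moreover have "\<forall>\<^sub>F \<epsilon> in at_right 0. \<forall>x\<in>K. u \<epsilon> x = v \<epsilon> x"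
    using eventually_unit_interval by eventually_elim (simp add: assms(2))
  ultimately show "uniform_limit K v a (at_right 0)"
    by (rule uniform_limit_cong[THEN iffD1, rotated 2]) auto
qed

lemma loc_unif_eventually_less:
  assumes "loc_unif u a" "compact K" "e > 0"
  shows "\<forall>\<^sub>F \<epsilon> in at_right 0. \<forall>z\<in>K. \<bar>u \<epsilon> z - a z\<bar> < e"
  using assms unfolding loc_unif_def uniform_limit_iff dist_real_def by blast

lemma loc_unif_eventually_bounded:
  assumes u: "loc_unif u a" and a: "continuous_on UNIV a" and K: "compact K"
  shows "\<exists>B\<ge>0. \<forall>\<^sub>F \<epsilon> in at_right 0. \<forall>z\<in>K. \<bar>u \<epsilon> z\<bar> \<le> B"
proof -
  have "bdd_above ((\<lambda>x. \<bar>a x\<bar>) ` K)"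
    using K by (intro bdd_above_abs_compact continuous_on_subset[OF a]) auto
  then obtain B where B: "\<And>x. x \<in> K \<Longrightarrow> \<bar>a x\<bar> \<le> B" by (auto simp: bdd_above_def)
  have "\<forall>\<^sub>F \<epsilon> in at_right 0. \<forall>z\<in>K. \<bar>u \<epsilon> z\<bar> \<le> \<bar>B\<bar> + 1"
    using loc_unif_eventually_less[OF u K zero_less_one]
  proof eventually_elim
    case (elim \<epsilon>)
    show ?case
    proof
      fix z assume "z \<in> K"
      with elim B[of z] show "\<bar>u \<epsilon> z\<bar> \<le> \<bar>B\<bar> + 1" by fastforce
    qed
  qed
  then show ?thesis by (intro exI[of _ "\<bar>B\<bar> + 1"]) auto
qed

text \<open>The sign \<open>\<sigma>\<close> treats both time directions at once.\<close>

lemma linear_transport_convergence_halfplane: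
  fixes lam :: "'n::finite \<Rightarrow> real \<times> real \<Rightarrow> real"
    and l v ge :: "'n \<Rightarrow> real \<Rightarrow> real \<times> real \<Rightarrow> real"
    and fe :: "'n \<Rightarrow> 'n \<Rightarrow> real \<Rightarrow> real \<times> real \<Rightarrow> real"
  assumes v: "\<And>i \<epsilon>. \<epsilon> \<in> {0<..1} \<Longrightarrow> C_k 1 (v i \<epsilon>)" and u: "\<And>i. C_k 1 (u i)"
    and lim_l: "\<And>i. loc_unif (l i) (lam i)" and lam: "\<And>i. continuous_on UNIV (lam i)"
    and lim_f: "\<And>i j. loc_unif (fe i j) (f i j)" and f: "\<And>i j. continuous_on UNIV (f i j)"
    and lim_g: "\<And>i. loc_unif (ge i) (g i)"
    and eqn_v: "\<And>i \<epsilon> z. \<epsilon> \<in> {0<..1} \<Longrightarrow> partial_deriv (0, 1) (v i \<epsilon>) z + l i \<epsilon> z * partial_deriv (1, 0) (v i \<epsilon>) z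
      = (\<Sum>j\<in>UNIV. fe i j \<epsilon> z * v j \<epsilon> z) + ge i \<epsilon> z"
    and eqn_u: "\<And>i z. partial_deriv (0, 1) (u i) z + lam i z * partial_deriv (1, 0) (u i) z
      = (\<Sum>j\<in>UNIV. f i j z * u j z) + g i z"
    and init: "\<And>i. loc_unif (\<lambda>\<epsilon> x. v i \<epsilon> (x, 0)) (\<lambda>x. u i (x, 0))"
    and UB: "\<And>i x t. \<bar>t\<bar> \<le> T \<Longrightarrow> \<bar>lam i (x, t)\<bar> \<le> c"
    and \<sigma>: "\<bar>\<sigma>\<bar> = 1" and T: "T \<ge> 0" and e: "e > 0"
  shows "\<forall>\<^sub>F \<epsilon> in at_right 0. \<forall>i x t. 0 \<le> t \<longrightarrow> t \<le> T \<longrightarrow> \<bar>x\<bar> \<le> R \<longrightarrow>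
    \<bar>v i \<epsilon> (x, \<sigma> * t) - u i (x, \<sigma> * t)\<bar> < e"
proof -
  \<comment> \<open>On \<open>K\<close> the regularized speeds are eventually within 1 of their
    limits, so this bounds them independently of \<epsilon>.\<close>
  define C where "C = \<bar>c\<bar> + 1"
  \<comment> \<open>A rectangle that contains the trapezoid for either sign of \<sigma>, so that all
    eventual bounds refer to one compact set.\<close>
  define K where "K = cbox (- (R + C * T), - T) (R + C * T, T)"
  have K: "compact K" by (simp add: K_def)
  have C: "C \<ge> 0" by (simp add: C_def)
  have inK: "(x, \<sigma> * t) \<in> K" if "0 \<le> t" "t \<le> T" "\<bar>x\<bar> \<le> R + C * (T - t)" for x t
  proof -
    have "C * (T - t) \<le> C * T" using C that by (intro mult_left_mono) auto
    moreover have "\<bar>\<sigma> * t\<bar> \<le> T" using \<sigma> that by (simp add: abs_mult)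
    ultimately show ?thesis using that unfolding K_def cbox_Pair_eq by auto
  qed
  have cont_u: "continuous_on UNIV (u i)" "continuous_on UNIV (partial_deriv (1, 0) (u i))" for i
    using u[of i] by (auto simp: Basis_prod_def)
  \<comment> \<open>In the equation for the difference \<open>v - u\<close> every coefficient error
    is paired with \<open>u\<close> or its derivative, which do not depend on \<epsilon>; the only
    factor left at \<open>v - u\<close> is \<open>fe\<close>.\<close>
  define r where "r i \<epsilon> z = (\<Sum>j\<in>UNIV. (fe i j \<epsilon> z - f i j z) * u j z) + (ge i \<epsilon> z - g i z)
      - (l i \<epsilon> z - lam i z) * partial_deriv (1, 0) (u i) z" for i \<epsilon> z
  have lim_r: "loc_unif (r i) (\<lambda>z. 0)" for i
  proof -
    have "loc_unif (\<lambda>\<epsilon> z. (fe i j \<epsilon> z - f i j z) * u j z) (\<lambda>z. (f i j z - f i j z) * u j z)" for j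
      using f cont_u(1) by (intro loc_unif_mult[OF loc_unif_diff[OF lim_f loc_unif_const] loc_unif_const]) simp_all
    note 1 = loc_unif_sum[OF this]
    have 2: "loc_unif (\<lambda>\<epsilon> z. (l i \<epsilon> z - lam i z) * partial_deriv (1, 0) (u i) z)
        (\<lambda>z. (lam i z - lam i z) * partial_deriv (1, 0) (u i) z)"
      using cont_u(2) by (intro loc_unif_mult[OF loc_unif_diff[OF lim_l loc_unif_const] loc_unif_const]) simp_all
    have "loc_unif (r i) (\<lambda>z. (\<Sum>j\<in>UNIV. (f i j z - f i j z) * u j z) + (g i z - g i z)
      - (lam i z - lam i z) * partial_deriv (1, 0) (u i) z)"
      unfolding r_def
      by (rule loc_unif_diff[OF loc_unif_add[OF 1 loc_unif_diff[OF lim_g loc_unif_const]] 2])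
    then show ?thesis by simp
  qed
  define F where "F i j = (SOME B. B \<ge> 0 \<and> (\<forall>\<^sub>F \<epsilon> in at_right 0. \<forall>z\<in>K. \<bar>fe i j \<epsilon> z\<bar> \<le> B))" for i j
  have "F i j \<ge> 0 \<and> (\<forall>\<^sub>F \<epsilon> in at_right 0. \<forall>z\<in>K. \<bar>fe i j \<epsilon> z\<bar> \<le> F i j)" for i j
    unfolding F_def by (rule someI_ex) (rule loc_unif_eventually_bounded[OF lim_f f K])
  then have F: "F i j \<ge> 0" "\<forall>\<^sub>F \<epsilon> in at_right 0. \<forall>z\<in>K. \<bar>fe i j \<epsilon> z\<bar> \<le> F i j" for i j
    by blast+
  \<comment> \<open>The sum over all entries dominates every row sum, so one rate serves all
    components.\<close>
  define A where "A = (\<Sum>i\<in>UNIV. \<Sum>j\<in>UNIV. F i j)"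
  have A: "A \<ge> 0" by (auto simp: A_def intro!: sum_nonneg F)
  \<comment> \<open>Chosen so that the barrier reaches exactly \<open>e\<close> at time
    \<open>T\<close>; the same \<eta> bounds the initial error and the remainder
    \<open>r\<close>.\<close>
  define \<eta> where "\<eta> = e / exp ((A + 2) * T)"
  have \<eta>: "\<eta> > 0" using e by (simp add: \<eta>_def)
  have ev_f: "\<forall>\<^sub>F \<epsilon> in at_right 0. \<forall>i j. \<forall>z\<in>K. \<bar>fe i j \<epsilon> z\<bar> \<le> F i j"
    by (intro eventually_all_finite F)
  have ev_r: "\<forall>\<^sub>F \<epsilon> in at_right 0. \<forall>i. \<forall>z\<in>K. \<bar>r i \<epsilon> z\<bar> < \<eta>"
    using loc_unif_eventually_less[OF lim_r K \<eta>] by (intro eventually_all_finite) simp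
  have ev_l: "\<forall>\<^sub>F \<epsilon> in at_right 0. \<forall>i. \<forall>z\<in>K. \<bar>l i \<epsilon> z - lam i z\<bar> < 1"
    by (intro eventually_all_finite loc_unif_eventually_less[OF lim_l K zero_less_one])
  have ev_0: "\<forall>\<^sub>F \<epsilon> in at_right 0. \<forall>i. \<forall>x\<in>{- (R + C * T)..R + C * T}. \<bar>v i \<epsilon> (x, 0) - u i (x, 0)\<bar> < \<eta>"
    by (intro eventually_all_finite loc_unif_eventually_less[OF init compact_Icc \<eta>])
  show ?thesis
    using ev_f ev_r ev_l ev_0 eventually_unit_interval
  proof eventually_elim
    case (elim \<epsilon>)
    let ?w = "\<lambda>i z. v i \<epsilon> (fst z, \<sigma> * snd z) - u i (fst z, \<sigma> * snd z)"
    have bound: "\<bar>?w i (x, t)\<bar> < \<eta> * exp ((A + 2) * t)"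
      if "0 \<le> t" "t \<le> T" "\<bar>x\<bar> \<le> R + C * (T - t)" for i x t
    proof (rule barrier_bound[where C = C and \<delta> = \<eta> and T = T and R = R])
      fix i
      have cont_v: "continuous_on UNIV (v i \<epsilon>)" using v[OF elim(5), of i] by simp
      show "continuous_on UNIV (?w i)"
        by (intro continuous_intros continuous_on_compose2[OF cont_v] continuous_on_compose2[OF cont_u(1)]) auto
    next
      fix i x t assume t: "0 < t" "t \<le> T" and x: "\<bar>x\<bar> \<le> R + C * (T - t)"
      let ?z = "(x, \<sigma> * t)"
      have z: "?z \<in> K" using inK t x by simp
      have \<sigma>t: "\<bar>\<sigma> * t\<bar> \<le> T" using \<sigma> t by (simp add: abs_mult)
      \<comment> \<open>Under the reflection of time by \<sigma> both the speed and the right side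
        of the equation pick up the factor \<sigma>.\<close>
      let ?c = "\<sigma> * l i \<epsilon> ?z" and ?h = "\<sigma> * ((\<Sum>j\<in>UNIV. fe i j \<epsilon> ?z * ?w j (x, t)) + r i \<epsilon> ?z)"
      have "\<bar>l i \<epsilon> ?z - lam i ?z\<bar> < 1" using elim(3) z by blast
      then have "\<bar>l i \<epsilon> ?z\<bar> \<le> C"
        using UB[OF \<sigma>t, of i x] unfolding C_def by linarith
      then have c: "\<bar>?c\<bar> \<le> C" using \<sigma> by (simp add: abs_mult)
      have w_eqn: "(partial_deriv (0, 1) (v i \<epsilon>) ?z + l i \<epsilon> ?z * partial_deriv (1, 0) (v i \<epsilon>) ?z)
          - (partial_deriv (0, 1) (u i) ?z + l i \<epsilon> ?z * partial_deriv (1, 0) (u i) ?z)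
          = (\<Sum>j\<in>UNIV. fe i j \<epsilon> ?z * ?w j (x, t)) + r i \<epsilon> ?z"
        unfolding eqn_v[OF elim(5)] r_def using eqn_u[of i ?z]
        by (simp add: algebra_simps sum_subtractf sum.distrib)
      have "((\<lambda>s. ?w i (x - s * ?c, t - s)) has_real_derivative
          - (\<sigma> * partial_deriv (0, 1) (v i \<epsilon>) ?z + ?c * partial_deriv (1, 0) (v i \<epsilon>) ?z)
          - - (\<sigma> * partial_deriv (0, 1) (u i) ?z + ?c * partial_deriv (1, 0) (u i) ?z)) (at 0)"
        unfolding fst_conv snd_conv
        by (intro DERIV_diff C1_has_derivative_line v elim(5) u)
      also have "- (\<sigma> * partial_deriv (0, 1) (v i \<epsilon>) ?z + ?c * partial_deriv (1, 0) (v i \<epsilon>) ?z)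
          - - (\<sigma> * partial_deriv (0, 1) (u i) ?z + ?c * partial_deriv (1, 0) (u i) ?z) = - ?h"
        unfolding w_eqn[symmetric] by (simp add: algebra_simps)
      finally have d: "((\<lambda>s. ?w i (x - s * ?c, t - s)) has_real_derivative - ?h) (at 0)" .
      have h: "\<bar>?h\<bar> \<le> A * m + \<eta>" if m: "\<forall>j. \<bar>?w j (x, t)\<bar> \<le> m" for m
      proof -
        have m0: "0 \<le> m" using m abs_ge_zero order_trans by blast
        have "\<bar>\<Sum>j\<in>UNIV. fe i j \<epsilon> ?z * ?w j (x, t)\<bar> \<le> (\<Sum>j\<in>UNIV. F i j * m)"
          using elim(1) z m F(1)
          by (intro order_trans[OF sum_abs] sum_mono) (auto simp: abs_mult intro!: mult_mono)
        also have "\<dots> = (\<Sum>j\<in>UNIV. F i j) * m" by (simp add: sum_distrib_right)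
        also have "\<dots> \<le> A * m"
          unfolding A_def using m0 F(1) by (intro mult_right_mono member_le_sum[of i UNIV "\<lambda>i. \<Sum>j\<in>UNIV. F i j"]) (auto intro!: sum_nonneg)
        finally have "\<bar>\<Sum>j\<in>UNIV. fe i j \<epsilon> ?z * ?w j (x, t)\<bar> \<le> A * m" .
        moreover have "\<bar>r i \<epsilon> ?z\<bar> \<le> \<eta>" using elim(2) z less_imp_le by blast
        moreover have "\<bar>?h\<bar> \<le> \<bar>\<Sum>j\<in>UNIV. fe i j \<epsilon> ?z * ?w j (x, t)\<bar> + \<bar>r i \<epsilon> ?z\<bar>"
          unfolding abs_mult \<sigma> mult_1 by (rule abs_triangle_ineq)
        ultimately show ?thesis by linarith
      qed
      from c d h show "\<exists>c h. \<bar>c\<bar> \<le> C \<and> ((\<lambda>s. ?w i (x - s * c, t - s)) has_real_derivative - h) (at 0) \<and>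
        (\<forall>m. (\<forall>j. \<bar>?w j (x, t)\<bar> \<le> m) \<longrightarrow> \<bar>h\<bar> \<le> A * m + \<eta>)" by blast
    next
      fix i x assume "\<bar>x\<bar> \<le> R + C * T"
      then have "x \<in> {- (R + C * T)..R + C * T}" by auto
      then show "\<bar>?w i (x, 0)\<bar> < \<eta>" using elim(4) by simp
    qed (use C \<eta> A that in auto)
    show ?case
    proof (intro allI impI)
      fix i x t assume t: "0 \<le> t" "t \<le> T" and x: "\<bar>x\<bar> \<le> R"
      have "0 \<le> C * (T - t)" using C t by simp
      then have "\<bar>?w i (x, t)\<bar> < \<eta> * exp ((A + 2) * t)" using x by (intro bound t) simp
      also have "\<dots> \<le> \<eta> * exp ((A + 2) * T)" using \<eta> A t by (auto intro!: mult_left_mono)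
      also have "\<dots> = e" by (simp add: \<eta>_def)
      finally show "\<bar>v i \<epsilon> (x, \<sigma> * t) - u i (x, \<sigma> * t)\<bar> < e" by simp
    qed
  qed
qed

lemma linear_transport_convergence:
  fixes lam :: "'n::finite \<Rightarrow> real \<times> real \<Rightarrow> real"
    and l v ge :: "'n \<Rightarrow> real \<Rightarrow> real \<times> real \<Rightarrow> real"
    and fe :: "'n \<Rightarrow> 'n \<Rightarrow> real \<Rightarrow> real \<times> real \<Rightarrow> real"
  assumes v: "\<And>i \<epsilon>. \<epsilon> \<in> {0<..1} \<Longrightarrow> C_k 1 (v i \<epsilon>)" and u: "\<And>i. C_k 1 (u i)"
    and lim_l: "\<And>i. loc_unif (l i) (lam i)" and lam: "\<And>i. continuous_on UNIV (lam i)"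
    and lim_f: "\<And>i j. loc_unif (fe i j) (f i j)" and f: "\<And>i j. continuous_on UNIV (f i j)"
    and lim_g: "\<And>i. loc_unif (ge i) (g i)"
    and eqn_v: "\<And>i \<epsilon> z. \<epsilon> \<in> {0<..1} \<Longrightarrow> partial_deriv (0, 1) (v i \<epsilon>) z + l i \<epsilon> z * partial_deriv (1, 0) (v i \<epsilon>) z
      = (\<Sum>j\<in>UNIV. fe i j \<epsilon> z * v j \<epsilon> z) + ge i \<epsilon> z"
    and eqn_u: "\<And>i z. partial_deriv (0, 1) (u i) z + lam i z * partial_deriv (1, 0) (u i) z
      = (\<Sum>j\<in>UNIV. f i j z * u j z) + g i z"
    and init: "\<And>i. loc_unif (\<lambda>\<epsilon> x. v i \<epsilon> (x, 0)) (\<lambda>x. u i (x, 0))"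
    and UB: "\<And>T. \<exists>c. \<forall>i x t. \<bar>t\<bar> \<le> T \<longrightarrow> \<bar>lam i (x, t)\<bar> \<le> c"
  shows "loc_unif (v i) (u i)"
  unfolding loc_unif_def
proof (intro allI impI uniform_limitI)
  fix K :: "(real \<times> real) set" and e :: real
  assume "compact K" and e: "e > 0"
  then obtain R where R: "\<And>z. z \<in> K \<Longrightarrow> norm z \<le> R"
    using compact_imp_bounded bounded_iff by metis
  \<comment> \<open>A bound on the norm limits \<open>x\<close> and \<open>t\<close> at once, so
    \<open>T\<close> serves as width and as height; the maximum with 0 covers an empty
    \<open>K\<close>, for which \<open>R\<close> may be negative.\<close>
  define T where "T = max R 0"
  obtain c where c: "\<And>i x t. \<bar>t\<bar> \<le> T \<Longrightarrow> \<bar>lam i (x, t)\<bar> \<le> c" using UB by blast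
  have "\<forall>\<^sub>F \<epsilon> in at_right 0. \<forall>i x t. 0 \<le> t \<longrightarrow> t \<le> T \<longrightarrow> \<bar>x\<bar> \<le> T \<longrightarrow>
      \<bar>v i \<epsilon> (x, \<sigma> * t) - u i (x, \<sigma> * t)\<bar> < e" if "\<bar>\<sigma>\<bar> = 1" for \<sigma>
    using v u lim_l lam lim_f f lim_g eqn_v eqn_u init c that _ e
    by (rule linear_transport_convergence_halfplane) (auto simp: T_def)
  from this[of 1, OF abs_one] this[of "-1", unfolded abs_minus_cancel, OF abs_one]
  show "\<forall>\<^sub>F \<epsilon> in at_right 0. \<forall>z\<in>K. dist (v i \<epsilon> z) (u i z) < e"
  proof eventually_elim
    case (elim \<epsilon>)
    show "\<forall>z\<in>K. dist (v i \<epsilon> z) (u i z) < e"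
    proof
      fix z assume z: "z \<in> K"
      obtain x t where xt: "z = (x, t)" by (cases z)
      have "\<bar>x\<bar> \<le> T" "\<bar>t\<bar> \<le> T"
        using R[OF z] norm_fst_le[of x t] norm_snd_le[of t x] by (auto simp: xt T_def)
      then show "dist (v i \<epsilon> z) (u i z) < e"
        using elim(1)[rule_format, of t x i] elim(2)[rule_format, of "- t" x i]
        by (cases "t \<ge> 0") (auto simp: xt dist_real_def)
    qed
  qed
qed

subsection \<open>Generalized random fields\<close>

text \<open>The test function confines the integrals to a box, where the error is at most a small
  constant times its absolute integral.\<close>

lemma loc_unif_imp_integral_tendsto:
  fixes v \<phi> :: "'a::euclidean_space \<Rightarrow> real"
  assumes lim: "loc_unif u v" and u: "\<And>\<epsilon>. \<epsilon> \<in> {0<..1} \<Longrightarrow> continuous_on UNIV (u \<epsilon>)"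
    and v: "continuous_on UNIV v" and \<phi>: "test_function \<phi>"
  shows "((\<lambda>\<epsilon>. \<integral>x. u \<epsilon> x * \<phi> x \<partial>lborel) \<longlongrightarrow> (\<integral>x. v x * \<phi> x \<partial>lborel)) (at_right 0)"
proof (rule tendstoI)
  fix e :: real assume e: "e > 0"
  have \<phi>c: "continuous_on UNIV \<phi>" using \<phi> by (simp add: test_function_def C_infinity_continuous)
  obtain p where "closure {x. \<phi> x \<noteq> 0} \<subseteq> cbox (-p) p"
    using \<phi> bounded_subset_cbox_symmetric compact_imp_bounded unfolding test_function_def by metis
  then have supp: "\<phi> x = 0" if "x \<notin> cbox (-p) p" for x
    using that closure_subset[of "{x. \<phi> x \<noteq> 0}"] by blast
  define J where "J = (\<integral>x. \<bar>\<phi> x\<bar> \<partial>lborel)"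
  have J: "J \<ge> 0" by (simp add: J_def)
  have int\<phi>: "integrable lborel \<phi>" using \<phi>c supp by (rule integral_lborel_cbox)
  have int: "integrable lborel (\<lambda>x. h x * \<phi> x)" if "continuous_on UNIV h" for h
    by (rule integral_lborel_cbox(1)[where p = "-p" and q = p]) (auto intro!: continuous_intros that \<phi>c simp: supp)
  define d where "d = e / (J + 1)"
  have d: "d > 0" "d * J < e" using e J by (auto simp: d_def field_simps)
  show "\<forall>\<^sub>F \<epsilon> in at_right 0. dist (\<integral>x. u \<epsilon> x * \<phi> x \<partial>lborel) (\<integral>x. v x * \<phi> x \<partial>lborel) < e"
    using loc_unif_eventually_less[OF lim compact_cbox d(1), of "-p" p] eventually_unit_interval
  proof eventually_elim
    case (elim \<epsilon>)
    have "(\<integral>x. u \<epsilon> x * \<phi> x \<partial>lborel) - (\<integral>x. v x * \<phi> x \<partial>lborel) = (\<integral>x. (u \<epsilon> x - v x) * \<phi> x \<partial>lborel)"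
      using int[OF u[OF elim(2)]] int[OF v] by (simp add: left_diff_distrib)
    also have "\<bar>\<dots>\<bar> \<le> (\<integral>x. \<bar>(u \<epsilon> x - v x) * \<phi> x\<bar> \<partial>lborel)" by (rule integral_abs_bound)
    also have "\<dots> \<le> (\<integral>x. d * \<bar>\<phi> x\<bar> \<partial>lborel)"
    proof (rule Bochner_Integration.integral_mono)
      show "integrable lborel (\<lambda>x. \<bar>(u \<epsilon> x - v x) * \<phi> x\<bar>)"
        by (intro integrable_abs int continuous_intros u elim v)
      show "integrable lborel (\<lambda>x. d * \<bar>\<phi> x\<bar>)"
        by (intro integrable_mult_right integrable_abs int\<phi>)
      fix x show "\<bar>(u \<epsilon> x - v x) * \<phi> x\<bar> \<le> d * \<bar>\<phi> x\<bar>"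
      proof (cases "x \<in> cbox (-p) p")
        case True
        then have "\<bar>u \<epsilon> x - v x\<bar> \<le> d" using elim(1) less_imp_le by blast
        then show ?thesis by (simp add: abs_mult mult_right_mono)
      qed (simp add: supp)
    qed
    also have "\<dots> = d * J" by (simp add: J_def)
    finally show ?case using d(2) by (simp add: dist_real_def)
  qed
qed

section \<open>Moderate random families, their classes and members of classes\<close>

lemma E_M_L0_iff: "u \<in> E_M_L0 M \<longleftrightarrow> (\<forall>\<epsilon>\<in>{0<..1}. random_field M (u \<epsilon>)) \<and>
    (AE \<omega> in M. (\<lambda>\<epsilon> x. u \<epsilon> x \<omega>) \<in> E_M)"
  unfolding E_M_L0_def by (auto simp: E_M_def elim!: eventually_mono)

lemma E_M_L0_mult:
  assumes "u \<in> E_M_L0 M" "v \<in> E_M_L0 M"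
  shows "(\<lambda>\<epsilon> x \<omega>. u \<epsilon> x \<omega> * v \<epsilon> x \<omega>) \<in> E_M_L0 M"
proof -
  have "AE \<omega> in M. (\<lambda>\<epsilon> x. u \<epsilon> x \<omega>) \<in> E_M" "AE \<omega> in M. (\<lambda>\<epsilon> x. v \<epsilon> x \<omega>) \<in> E_M"
    using assms by (simp_all add: E_M_L0_iff)
  then have "AE \<omega> in M. (\<lambda>\<epsilon> x. u \<epsilon> x \<omega> * v \<epsilon> x \<omega>) \<in> E_M"
    by eventually_elim (rule E_M_mult)
  then show ?thesis using assms by (auto simp: E_M_L0_iff random_field_def intro!: borel_measurable_times)
qed

lemma E_M_L0_add:
  assumes "u \<in> E_M_L0 M" "v \<in> E_M_L0 M"
  shows "(\<lambda>\<epsilon> x \<omega>. u \<epsilon> x \<omega> + v \<epsilon> x \<omega>) \<in> E_M_L0 M"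
proof -
  have "AE \<omega> in M. (\<lambda>\<epsilon> x. u \<epsilon> x \<omega>) \<in> E_M" "AE \<omega> in M. (\<lambda>\<epsilon> x. v \<epsilon> x \<omega>) \<in> E_M"
    using assms by (simp_all add: E_M_L0_iff)
  then have "AE \<omega> in M. (\<lambda>\<epsilon> x. u \<epsilon> x \<omega> + v \<epsilon> x \<omega>) \<in> E_M"
    by eventually_elim (rule E_M_add)
  then show ?thesis using assms by (auto simp: E_M_L0_iff random_field_def intro!: borel_measurable_add)
qed

lemma E_M_L0_sum:
  fixes u :: "'n::finite \<Rightarrow> ('a::euclidean_space, 'w) field_family"
  assumes "\<And>j. u j \<in> E_M_L0 M"
  shows "(\<lambda>\<epsilon> x \<omega>. \<Sum>j\<in>UNIV. u j \<epsilon> x \<omega>) \<in> E_M_L0 M"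
proof -
  have "AE \<omega> in M. \<forall>j. (\<lambda>\<epsilon> x. u j \<epsilon> x \<omega>) \<in> E_M"
    using assms by (intro eventually_all_finite) (simp add: E_M_L0_iff)
  then have "AE \<omega> in M. (\<lambda>\<epsilon> x. \<Sum>j\<in>UNIV. u j \<epsilon> x \<omega>) \<in> E_M"
    by eventually_elim (simp add: E_M_sum)
  then show ?thesis
    using assms by (auto simp: E_M_L0_iff random_field_def intro!: borel_measurable_sum)
qed

lemma gen_class_iff: "v \<in> gen_class M u \<longleftrightarrow> u \<in> E_M_L0 M \<and> v \<in> E_M_L0 M \<and>
    (\<lambda>\<epsilon> x \<omega>. u \<epsilon> x \<omega> - v \<epsilon> x \<omega>) \<in> N_L0 M"
  by (simp add: gen_class_def gen_rel_def)

lemma gen_class_self: "u \<in> E_M_L0 M \<Longrightarrow> u \<in> gen_class M u"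
  by (simp add: gen_class_iff N_L0_def random_field_def N_ideal_zero)

lemma N_L0_loc_unif:
  assumes "u \<in> N_L0 M"
  shows "AE \<omega> in M. loc_unif (\<lambda>\<epsilon> x. u \<epsilon> x \<omega>) (\<lambda>x. 0)"
proof -
  have "AE \<omega> in M. (\<lambda>\<epsilon> x. u \<epsilon> x \<omega>) \<in> N_ideal" using assms by (simp add: N_L0_def)
  then show ?thesis
  proof eventually_elim
    case (elim \<omega>)
    from N_ideal_loc_unif[OF this, of "[]"] show ?case by simp
  qed
qed

text \<open>Negligibility covers the derivative of the difference; smoothness of both families is
  what splits it into a difference of derivatives.\<close>

lemma N_L0_partial_deriv_loc_unif:
  assumes "(\<lambda>\<epsilon> x \<omega>. u \<epsilon> x \<omega> - v \<epsilon> x \<omega>) \<in> N_L0 M" "u \<in> E_M_L0 M" "v \<in> E_M_L0 M" "b \<in> Basis"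
  shows "AE \<omega> in M. loc_unif
    (\<lambda>\<epsilon> x. partial_deriv b (\<lambda>x. u \<epsilon> x \<omega>) x - partial_deriv b (\<lambda>x. v \<epsilon> x \<omega>) x) (\<lambda>x. 0)"
proof -
  have "AE \<omega> in M. (\<lambda>\<epsilon> x. u \<epsilon> x \<omega>) \<in> E_M" "AE \<omega> in M. (\<lambda>\<epsilon> x. v \<epsilon> x \<omega>) \<in> E_M"
    "AE \<omega> in M. (\<lambda>\<epsilon> x. u \<epsilon> x \<omega> - v \<epsilon> x \<omega>) \<in> N_ideal"
    using assms by (simp_all add: E_M_L0_iff N_L0_def)
  then show ?thesis
  proof eventually_elim
    case (elim \<omega>)
    have "loc_unif (\<lambda>\<epsilon>. partial_derivs [b] (\<lambda>x. u \<epsilon> x \<omega> - v \<epsilon> x \<omega>)) (\<lambda>x. 0)"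
      using elim(3) assms(4) by (intro N_ideal_loc_unif) auto
    then show ?case
      by (rule loc_unif_cong)
        (use elim assms(4) in \<open>auto simp: partial_derivs_Cons partial_deriv_diff E_M_iff C_infinityD\<close>)
  qed
qed

lemma G_L0_E_M_L0: "U \<in> G_L0 M \<Longrightarrow> v \<in> U \<Longrightarrow> v \<in> E_M_L0 M"
  by (auto simp: G_L0_def quotient_def gen_rel_def)

lemma G_L0_nonempty: "U \<in> G_L0 M \<Longrightarrow> \<exists>v. v \<in> U"
  using gen_class_self by (fastforce simp: G_L0_def quotient_def gen_class_def)

text \<open>Two members of a class are compared through the family \<open>x\<close> that generates
  it.\<close>

lemma G_L0_obtain:
  assumes "U \<in> G_L0 M" "v \<in> U" "v' \<in> U"
  obtains x where "x \<in> E_M_L0 M" "(\<lambda>\<epsilon> z \<omega>. x \<epsilon> z \<omega> - v \<epsilon> z \<omega>) \<in> N_L0 M"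
    "(\<lambda>\<epsilon> z \<omega>. x \<epsilon> z \<omega> - v' \<epsilon> z \<omega>) \<in> N_L0 M"
  using assms by (auto simp: G_L0_def quotient_def gen_rel_def)

lemma loc_unif_diff_zero:
  "loc_unif (\<lambda>\<epsilon> x. w \<epsilon> x - u \<epsilon> x) (\<lambda>x. 0) \<Longrightarrow> loc_unif (\<lambda>\<epsilon> x. w \<epsilon> x - v \<epsilon> x) (\<lambda>x. 0) \<Longrightarrow>
    loc_unif (\<lambda>\<epsilon> x. u \<epsilon> x - v \<epsilon> x) (\<lambda>x. 0)"
  using loc_unif_diff[of "\<lambda>\<epsilon> x. w \<epsilon> x - v \<epsilon> x" "\<lambda>x. 0" "\<lambda>\<epsilon> x. w \<epsilon> x - u \<epsilon> x" "\<lambda>x. 0"] by simp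

lemma loc_unif_transform:
  "loc_unif u a \<Longrightarrow> loc_unif (\<lambda>\<epsilon> x. u \<epsilon> x - v \<epsilon> x) (\<lambda>x. 0) \<Longrightarrow> loc_unif v a"
  using loc_unif_diff[of u a "\<lambda>\<epsilon> x. u \<epsilon> x - v \<epsilon> x" "\<lambda>x. 0"] by simp

lemma loc_unif_restrict:
  fixes u :: "real \<Rightarrow> 'a::topological_space \<times> 'b::{topological_space, zero} \<Rightarrow> real"
  assumes "loc_unif u (\<lambda>z. c)"
  shows "loc_unif (\<lambda>\<epsilon> x. u \<epsilon> (x, 0)) (\<lambda>x. c)"
  unfolding loc_unif_def
proof (intro allI impI)
  fix K :: "'a set" assume "compact K"
  then have "uniform_limit (K \<times> {0}) u (\<lambda>z. c) (at_right 0)"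
    using assms by (simp add: loc_unif_def compact_Times)
  then show "uniform_limit K (\<lambda>\<epsilon> x. u \<epsilon> (x, 0)) (\<lambda>x. c) (at_right 0)"
    by (rule uniform_limit_compose') auto
qed

lemma G_L0_loc_unif:
  assumes "U \<in> G_L0 M" "v \<in> U" "v' \<in> U"
  shows "AE \<omega> in M. loc_unif (\<lambda>\<epsilon> z. v \<epsilon> z \<omega> - v' \<epsilon> z \<omega>) (\<lambda>z. 0)"
proof -
  obtain x where x: "(\<lambda>\<epsilon> z \<omega>. x \<epsilon> z \<omega> - v \<epsilon> z \<omega>) \<in> N_L0 M" "(\<lambda>\<epsilon> z \<omega>. x \<epsilon> z \<omega> - v' \<epsilon> z \<omega>) \<in> N_L0 M"
    using G_L0_obtain[OF assms] .
  from x[THEN N_L0_loc_unif] show ?thesis by eventually_elim (rule loc_unif_diff_zero)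
qed

text \<open>The family \<open>p\<close> comes from the derivative of some representative
  \<open>v'\<close>, not of \<open>v\<close>; since derivatives of negligible families tend to 0 as
  well, the choice of the representative costs only a null error.\<close>

lemma gen_deriv_loc_unif:
  assumes U: "U \<in> G_L0 M" "v \<in> U" and p: "p \<in> gen_deriv M b U" and b: "b \<in> Basis"
  shows "AE \<omega> in M. loc_unif (\<lambda>\<epsilon> z. partial_deriv b (\<lambda>z. v \<epsilon> z \<omega>) z - p \<epsilon> z \<omega>) (\<lambda>z. 0)"
proof -
  obtain v' where v': "v' \<in> U" "p \<in> gen_class M (\<lambda>\<epsilon> z \<omega>. partial_deriv b (\<lambda>y. v' \<epsilon> y \<omega>) z)"
    using p by (auto simp: gen_deriv_def)
  obtain x where x: "x \<in> E_M_L0 M" "(\<lambda>\<epsilon> z \<omega>. x \<epsilon> z \<omega> - v \<epsilon> z \<omega>) \<in> N_L0 M"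
      "(\<lambda>\<epsilon> z \<omega>. x \<epsilon> z \<omega> - v' \<epsilon> z \<omega>) \<in> N_L0 M"
    using G_L0_obtain[OF U v'(1)] .
  have "(\<lambda>\<epsilon> z \<omega>. partial_deriv b (\<lambda>y. v' \<epsilon> y \<omega>) z - p \<epsilon> z \<omega>) \<in> N_L0 M"
    using v'(2) by (simp add: gen_class_iff)
  from N_L0_loc_unif[OF this] N_L0_partial_deriv_loc_unif[OF x(2,1) G_L0_E_M_L0[OF U] b]
    N_L0_partial_deriv_loc_unif[OF x(3,1) G_L0_E_M_L0[OF U(1) v'(1)] b]
  show ?thesis
  proof eventually_elim
    case (elim \<omega>)
    from loc_unif_add[OF loc_unif_diff_zero[OF elim(2,3)] elim(1)] show ?case by simp
  qed
qed

text \<open>The operations are unions of classes; a moderate family belongs to its own class and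
  hence to the union.\<close>

lemma gen_add_memI: "a \<in> U \<Longrightarrow> b \<in> V \<Longrightarrow> (\<lambda>\<epsilon> x \<omega>. a \<epsilon> x \<omega> + b \<epsilon> x \<omega>) \<in> E_M_L0 M \<Longrightarrow>
    (\<lambda>\<epsilon> x \<omega>. a \<epsilon> x \<omega> + b \<epsilon> x \<omega>) \<in> gen_add M U V"
  and gen_mult_memI: "a \<in> U \<Longrightarrow> b \<in> V \<Longrightarrow> (\<lambda>\<epsilon> x \<omega>. a \<epsilon> x \<omega> * b \<epsilon> x \<omega>) \<in> E_M_L0 M \<Longrightarrow>
    (\<lambda>\<epsilon> x \<omega>. a \<epsilon> x \<omega> * b \<epsilon> x \<omega>) \<in> gen_mult M U V"
  and gen_sum_memI: "(\<And>j. c j \<in> W j) \<Longrightarrow> (\<lambda>\<epsilon> x \<omega>. \<Sum>j\<in>UNIV. c j \<epsilon> x \<omega>) \<in> E_M_L0 M \<Longrightarrow>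
    (\<lambda>\<epsilon> x \<omega>. \<Sum>j\<in>UNIV. c j \<epsilon> x \<omega>) \<in> gen_sum M W"
  unfolding gen_add_def gen_mult_def gen_sum_def by (blast intro: gen_class_self)+

section \<open>The embedding of random fields\<close>

definition embed :: "('a::euclidean_space \<Rightarrow> real) \<Rightarrow> ('a \<Rightarrow> real) \<Rightarrow> ('a \<Rightarrow> 'w \<Rightarrow> real) \<Rightarrow>
    ('a, 'w) field_family" where
  "embed \<rho> \<theta> X = (\<lambda>\<epsilon> x \<omega>. convolve (\<lambda>y. X y \<omega>) (\<lambda>y. \<theta> y * scaled \<rho> \<epsilon> y) x)"

lemma iota_eq: "iota M \<rho> \<theta> X = gen_class M (embed \<rho> \<theta> X)"
  by (simp add: iota_def embed_def)

lemma C1_paths_continuous: "C1_paths M X \<Longrightarrow> AE \<omega> in M. continuous_on UNIV (\<lambda>x. X x \<omega>)"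
  unfolding C1_paths_def by (auto elim!: eventually_mono intro: C_k_imp_continuous)

lemma cutoffD:
  assumes "cutoff \<theta>"
  shows "C_infinity \<theta>" "\<exists>R. supp_in R \<theta>" "\<theta> 0 = 1"
proof -
  show "C_infinity \<theta>" "\<theta> 0 = 1"
    using assms eventually_nhds_x_imp_x by (auto simp: cutoff_def test_function_def)
  have "bounded {x. \<theta> x \<noteq> 0}"
    using assms closure_subset bounded_subset compact_imp_bounded
    unfolding cutoff_def test_function_def by metis
  then obtain R where "\<And>x. \<theta> x \<noteq> 0 \<Longrightarrow> norm x \<le> R" by (auto simp: bounded_iff)
  then show "\<exists>R. supp_in R \<theta>" unfolding supp_in_def by (meson not_le)
qed

text \<open>The kernels form a moderate family with supports in one ball, so moderateness passes to
  the convolution on every continuous path. It follows that \<open>iota\<close> contains the family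
  by which it is defined.\<close>

lemma embed_E_M_L0:
  assumes M: "complete_measure M" and \<rho>: "mollifier \<rho>" and \<theta>: "cutoff \<theta>"
    and X: "random_field M X" "C1_paths M X"
  shows "embed \<rho> \<theta> X \<in> E_M_L0 M"
proof -
  obtain R where R: "supp_in R \<theta>" using cutoffD(2)[OF \<theta>] by blast
  let ?\<psi> = "\<lambda>\<epsilon> y. \<theta> y * scaled \<rho> \<epsilon> y"
  have \<psi>: "?\<psi> \<in> E_M"
    using \<rho> cutoffD(1)[OF \<theta>] by (intro E_M_mult E_M_const_family E_M_scaled) (simp_all add: mollifier_def)
  have "supp_in R (?\<psi> \<epsilon>)" for \<epsilon> using R by (simp add: supp_in_def)
  then have "AE \<omega> in M. (\<lambda>\<epsilon> x. embed \<rho> \<theta> X \<epsilon> x \<omega>) \<in> E_M"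
    using C1_paths_continuous[OF X(2)] unfolding embed_def
    by (elim eventually_mono) (rule E_M_convolve[OF _ \<psi>])
  moreover have "random_field M (embed \<rho> \<theta> X \<epsilon>)" if "\<epsilon> \<in> {0<..1}" for \<epsilon>
    unfolding random_field_def embed_def
  proof
    fix x
    have "?\<psi> \<epsilon> \<in> borel_measurable borel"
      using \<psi> that by (intro borel_measurable_continuous_onI C_infinity_continuous) (simp add: E_M_iff)
    then show "(\<lambda>\<omega>. convolve (\<lambda>y. X y \<omega>) (?\<psi> \<epsilon>) x) \<in> borel_measurable M"
      using X(1) by (intro borel_measurable_convolve M C1_paths_continuous X(2)) (auto simp: random_field_def)
  qed
  ultimately show ?thesis by (simp add: E_M_L0_iff)
qed

lemma embed_loc_unif:
  assumes "mollifier \<rho>" "cutoff \<theta>" "C1_paths M X"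
  shows "AE \<omega> in M. loc_unif (\<lambda>\<epsilon> x. embed \<rho> \<theta> X \<epsilon> x \<omega>) (\<lambda>x. X x \<omega>)"
  using C1_paths_continuous[OF assms(3)]
proof eventually_elim
  case (elim \<omega>)
  obtain R where R: "supp_in R \<theta>" using cutoffD(2)[OF assms(2)] by blast
  show ?case
    unfolding embed_def
    by (rule convolve_loc_unif[OF elim _ _ _ R])
      (use assms cutoffD[OF assms(2)] in \<open>auto simp: mollifier_def C_infinity_continuous\<close>)
qed

lemma iota_loc_unif:
  assumes "mollifier \<rho>" "cutoff \<theta>" "C1_paths M X" "Y \<in> iota M \<rho> \<theta> X"
  shows "AE \<omega> in M. loc_unif (\<lambda>\<epsilon> x. Y \<epsilon> x \<omega>) (\<lambda>x. X x \<omega>)"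
proof -
  have "(\<lambda>\<epsilon> x \<omega>. embed \<rho> \<theta> X \<epsilon> x \<omega> - Y \<epsilon> x \<omega>) \<in> N_L0 M"
    using assms(4) by (simp add: iota_eq gen_class_iff)
  from N_L0_loc_unif[OF this] embed_loc_unif[OF assms(1-3)]
  show ?thesis by eventually_elim (rule loc_unif_transform)
qed

text \<open>The exceptional set in (UB) depends on the time interval. Countably many intervals
  exhaust the line, so a single null set suffices for all \<open>T\<close>.\<close>

lemma cond_UB_pathwise:
  fixes lam :: "'n::finite \<Rightarrow> real \<times> real \<Rightarrow> 'w \<Rightarrow> real"
  assumes "cond_UB M lam"
  shows "AE \<omega> in M. \<forall>T. \<exists>c. \<forall>i x t. \<bar>t\<bar> \<le> T \<longrightarrow> \<bar>lam i (x, t) \<omega>\<bar> \<le> c"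
proof -
  have "\<exists>c. AE \<omega> in M. \<forall>i x. \<forall>t\<in>{- real N..real N}. \<bar>lam i (x, t) \<omega>\<bar> \<le> c" for N
  proof -
    obtain c where c: "\<And>i. AE \<omega> in M. \<forall>x. \<forall>t\<in>{- real N..real N}. \<bar>lam i (x, t) \<omega>\<bar> \<le> c"
      using assms unfolding cond_UB_def by meson
    show ?thesis by (intro exI[of _ c] eventually_all_finite c)
  qed
  then have "\<forall>N. \<exists>c. AE \<omega> in M. \<forall>i x. \<forall>t\<in>{- real N..real N}. \<bar>lam i (x, t) \<omega>\<bar> \<le> c" by blast
  from choice[OF this] obtain c where
    "\<forall>N. AE \<omega> in M. \<forall>i x. \<forall>t\<in>{- real N..real N}. \<bar>lam i (x, t) \<omega>\<bar> \<le> c N" ..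
  then have "AE \<omega> in M. \<forall>N. \<forall>i x. \<forall>t\<in>{- real N..real N}. \<bar>lam i (x, t) \<omega>\<bar> \<le> c N"
    by (rule AE_all_countable[THEN iffD2])
  then show ?thesis
  proof eventually_elim
    case (elim \<omega>)
    show ?case
    proof
      fix T :: real
      obtain N where N: "T \<le> real N" using real_arch_simple by blast
      have "\<bar>lam i (x, t) \<omega>\<bar> \<le> c N" if "\<bar>t\<bar> \<le> T" for i x t
      proof -
        have "t \<in> {- real N..real N}" using that N by auto
        then show ?thesis using elim by blast
      qed
      then show "\<exists>c. \<forall>i x t. \<bar>t\<bar> \<le> T \<longrightarrow> \<bar>lam i (x, t) \<omega>\<bar> \<le> c" by blast
    qed
  qed
qed

text \<open>Unfolding the operations yields representatives \<open>p\<close>, \<open>q\<close>,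
  \<open>l\<close>, \<open>d\<close> chosen independently of \<open>v\<close>. Replacing
  \<open>p\<close> and \<open>d\<close> by derivatives of \<open>v\<close> is harmless, because the
  error at \<open>d\<close> is multiplied only by \<open>l\<close>, which converges to a continuous
  limit.\<close>

lemma gen_solution_equation:
  fixes lam :: "real \<times> real \<Rightarrow> 'w \<Rightarrow> real" and U L :: "(real \<times> real, 'w) field_family set"
  assumes L: "\<And>Y. Y \<in> L \<Longrightarrow> AE \<omega> in M. loc_unif (\<lambda>\<epsilon> z. Y \<epsilon> z \<omega>) (\<lambda>z. lam z \<omega>)"
    and lam: "AE \<omega> in M. continuous_on UNIV (\<lambda>z. lam z \<omega>)"
    and U: "U \<in> G_L0 M" and v: "v \<in> U"
    and r: "r \<in> gen_add M (gen_deriv M (0, 1) U) (gen_mult M L (gen_deriv M (1, 0) U))"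
  shows "\<exists>l. AE \<omega> in M. loc_unif (\<lambda>\<epsilon> z. l \<epsilon> z \<omega>) (\<lambda>z. lam z \<omega>) \<and>
    loc_unif (\<lambda>\<epsilon> z. partial_deriv (0, 1) (\<lambda>z. v \<epsilon> z \<omega>) z
      + l \<epsilon> z \<omega> * partial_deriv (1, 0) (\<lambda>z. v \<epsilon> z \<omega>) z - r \<epsilon> z \<omega>) (\<lambda>z. 0)"
proof -
  obtain p q where p: "p \<in> gen_deriv M (0, 1) U" and q: "q \<in> gen_mult M L (gen_deriv M (1, 0) U)"
    and "r \<in> gen_class M (\<lambda>\<epsilon> z \<omega>. p \<epsilon> z \<omega> + q \<epsilon> z \<omega>)"
    using r by (auto simp: gen_add_def)
  then have rN: "(\<lambda>\<epsilon> z \<omega>. (p \<epsilon> z \<omega> + q \<epsilon> z \<omega>) - r \<epsilon> z \<omega>) \<in> N_L0 M" by (simp add: gen_class_iff)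
  obtain l d where l: "l \<in> L" and d: "d \<in> gen_deriv M (1, 0) U"
    and "q \<in> gen_class M (\<lambda>\<epsilon> z \<omega>. l \<epsilon> z \<omega> * d \<epsilon> z \<omega>)"
    using q by (auto simp: gen_mult_def)
  then have qN: "(\<lambda>\<epsilon> z \<omega>. l \<epsilon> z \<omega> * d \<epsilon> z \<omega> - q \<epsilon> z \<omega>) \<in> N_L0 M" by (simp add: gen_class_iff)
  have basis: "(0, 1) \<in> (Basis :: (real \<times> real) set)" "(1, 0) \<in> (Basis :: (real \<times> real) set)"
    by (auto simp: Basis_prod_def)
  from L[OF l] lam N_L0_loc_unif[OF rN] N_L0_loc_unif[OF qN]
    gen_deriv_loc_unif[OF U v p basis(1)] gen_deriv_loc_unif[OF U v d basis(2)]
  have "AE \<omega> in M. loc_unif (\<lambda>\<epsilon> z. l \<epsilon> z \<omega>) (\<lambda>z. lam z \<omega>) \<and>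
    loc_unif (\<lambda>\<epsilon> z. partial_deriv (0, 1) (\<lambda>z. v \<epsilon> z \<omega>) z
      + l \<epsilon> z \<omega> * partial_deriv (1, 0) (\<lambda>z. v \<epsilon> z \<omega>) z - r \<epsilon> z \<omega>) (\<lambda>z. 0)"
  proof eventually_elim
    case (elim \<omega>)
    \<comment> \<open>The first of four null families; in the sum of all four, \<open>p\<close>,
      \<open>q\<close> and the product \<open>l * d\<close> cancel.\<close>
    from loc_unif_mult[OF elim(1,6,2)]
    have "loc_unif (\<lambda>\<epsilon> z. l \<epsilon> z \<omega> * (partial_deriv (1, 0) (\<lambda>z. v \<epsilon> z \<omega>) z - d \<epsilon> z \<omega>)) (\<lambda>z. 0)"
      by simp
    from loc_unif_add[OF loc_unif_add[OF this elim(5)] loc_unif_add[OF elim(3,4)]] elim(1)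
    show ?case by (simp add: algebra_simps)
  qed
  then show ?thesis by (rule exI[of _ l])
qed

text \<open>The class equations become finitely many almost sure statements about chosen
  representatives; on a path where all of them hold, the deterministic convergence result
  applies.\<close>

lemma gen_solution_locally_uniform:
  fixes M :: "'w measure"
    and lam g uc :: "'n::finite \<Rightarrow> real \<times> real \<Rightarrow> 'w \<Rightarrow> real"
    and f :: "'n \<Rightarrow> 'n \<Rightarrow> real \<times> real \<Rightarrow> 'w \<Rightarrow> real"
    and u0 :: "'n \<Rightarrow> real \<Rightarrow> 'w \<Rightarrow> real"
    and u :: "'n \<Rightarrow> (real \<times> real, 'w) field_family set"
  assumes M: "complete_measure M"
    and \<rho>1: "mollifier \<rho>1" "cutoff \<theta>1" and \<rho>2: "mollifier \<rho>2" "cutoff \<theta>2"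
    and lam: "\<And>i. C1_paths M (lam i)"
    and f: "\<And>i j. random_field M (f i j)" "\<And>i j. C1_paths M (f i j)"
    and g: "\<And>i. random_field M (g i)" "\<And>i. C1_paths M (g i)"
    and u0: "\<And>i. random_field M (u0 i)" "\<And>i. C1_paths M (u0 i)"
    and UB: "cond_UB M lam"
    and uc: "classical_solution M lam f g u0 uc"
    and u: "generalized_solution M
           (\<lambda>i. iota M \<rho>2 \<theta>2 (lam i)) (\<lambda>i j. iota M \<rho>2 \<theta>2 (f i j))
           (\<lambda>i. iota M \<rho>2 \<theta>2 (g i)) (\<lambda>i. iota M \<rho>1 \<theta>1 (u0 i)) u"
    and v: "\<And>i. v i \<in> u i"
  shows "AE \<omega> in M. \<forall>i. loc_unif (\<lambda>\<epsilon> z. v i \<epsilon> z \<omega>) (\<lambda>z. uc i z \<omega>)"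
proof -
  have uG: "u i \<in> G_L0 M" for i using u by (simp add: generalized_solution_def)
  have vE: "v i \<in> E_M_L0 M" for i using G_L0_E_M_L0[OF uG v] .
  let ?F = "\<lambda>i j. embed \<rho>2 \<theta>2 (f i j)" and ?G = "\<lambda>i. embed \<rho>2 \<theta>2 (g i)"
  let ?S = "\<lambda>i \<epsilon> z \<omega>. \<Sum>j\<in>UNIV. ?F i j \<epsilon> z \<omega> * v j \<epsilon> z \<omega>"
  let ?R = "\<lambda>i \<epsilon> z \<omega>. ?S i \<epsilon> z \<omega> + ?G i \<epsilon> z \<omega>"
  have FE: "?F i j \<in> E_M_L0 M" and GE: "?G i \<in> E_M_L0 M" for i j
    using M \<rho>2 f g by (auto intro: embed_E_M_L0)
  have FvE: "(\<lambda>\<epsilon> z \<omega>. ?F i j \<epsilon> z \<omega> * v j \<epsilon> z \<omega>) \<in> E_M_L0 M" for i j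
    by (intro E_M_L0_mult FE vE)
  have SE: "?S i \<in> E_M_L0 M" for i by (intro E_M_L0_sum FvE)
  have RE: "?R i \<in> E_M_L0 M" for i by (intro E_M_L0_add SE GE)
  have iota_self: "embed \<rho>2 \<theta>2 X \<in> iota M \<rho>2 \<theta>2 X" if "embed \<rho>2 \<theta>2 X \<in> E_M_L0 M" for X
    using that unfolding iota_eq by (rule gen_class_self)
  \<comment> \<open>An explicit member of the right side, built from the embedded coefficients and
    \<open>v\<close> itself. By equality of the classes it is a member of the left side too, which
    is how the equation reaches \<open>v\<close>.\<close>
  have "?R i \<in> gen_add M (gen_sum M (\<lambda>j. gen_mult M (iota M \<rho>2 \<theta>2 (f i j)) (u j))) (iota M \<rho>2 \<theta>2 (g i))" for i
    using iota_self[OF FE] v FvE iota_self[OF GE] SE RE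
    by (intro gen_add_memI gen_sum_memI gen_mult_memI)
  then have R: "?R i \<in> gen_add M (gen_deriv M (0, 1) (u i))
      (gen_mult M (iota M \<rho>2 \<theta>2 (lam i)) (gen_deriv M (1, 0) (u i)))" for i
    using u by (simp add: generalized_solution_def)
  have "\<forall>i. \<exists>l. AE \<omega> in M. loc_unif (\<lambda>\<epsilon> z. l \<epsilon> z \<omega>) (\<lambda>z. lam i z \<omega>) \<and>
    loc_unif (\<lambda>\<epsilon> z. partial_deriv (0, 1) (\<lambda>z. v i \<epsilon> z \<omega>) z
      + l \<epsilon> z \<omega> * partial_deriv (1, 0) (\<lambda>z. v i \<epsilon> z \<omega>) z - ?R i \<epsilon> z \<omega>) (\<lambda>z. 0)"
    by (intro allI gen_solution_equation[OF iota_loc_unif[OF \<rho>2 lam] C1_paths_continuous[OF lam] uG v R])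
  from choice[OF this] obtain l where l: "\<forall>i. AE \<omega> in M. loc_unif (\<lambda>\<epsilon> z. l i \<epsilon> z \<omega>) (\<lambda>z. lam i z \<omega>) \<and>
    loc_unif (\<lambda>\<epsilon> z. partial_deriv (0, 1) (\<lambda>z. v i \<epsilon> z \<omega>) z
      + l i \<epsilon> z \<omega> * partial_deriv (1, 0) (\<lambda>z. v i \<epsilon> z \<omega>) z - ?R i \<epsilon> z \<omega>) (\<lambda>z. 0)" ..
  have ev_l: "AE \<omega> in M. \<forall>i. loc_unif (\<lambda>\<epsilon> z. l i \<epsilon> z \<omega>) (\<lambda>z. lam i z \<omega>) \<and>
    loc_unif (\<lambda>\<epsilon> z. partial_deriv (0, 1) (\<lambda>z. v i \<epsilon> z \<omega>) z
      + l i \<epsilon> z \<omega> * partial_deriv (1, 0) (\<lambda>z. v i \<epsilon> z \<omega>) z - ?R i \<epsilon> z \<omega>) (\<lambda>z. 0)"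
    by (rule eventually_all_finite) (rule l[rule_format])
  have ev_init: "AE \<omega> in M. \<forall>i. loc_unif (\<lambda>\<epsilon> x. v i \<epsilon> (x, 0) \<omega>) (\<lambda>x. u0 i x \<omega>)"
  proof (rule eventually_all_finite)
    fix i
    let ?U0 = "embed \<rho>1 \<theta>1 (u0 i)"
    have "?U0 \<in> iota M \<rho>1 \<theta>1 (u0 i)"
      unfolding iota_eq by (intro gen_class_self embed_E_M_L0 M \<rho>1 u0)
    then have "?U0 \<in> restrict_t0 M (u i)" using u by (simp add: generalized_solution_def)
    \<comment> \<open>The restriction comes with a representative \<open>v'\<close> of its own; it
      is compared with \<open>v i\<close> in the plane before passing to time 0.\<close>
    then obtain v' where v': "v' \<in> u i" "?U0 \<in> gen_class M (\<lambda>\<epsilon> x \<omega>. v' \<epsilon> (x, 0) \<omega>)"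
      by (auto simp: restrict_t0_def)
    then have "(\<lambda>\<epsilon> x \<omega>. v' \<epsilon> (x, 0) \<omega> - ?U0 \<epsilon> x \<omega>) \<in> N_L0 M" by (simp add: gen_class_iff)
    from N_L0_loc_unif[OF this] G_L0_loc_unif[OF uG v v'(1)] embed_loc_unif[OF \<rho>1 u0(2)[of i]]
    show "AE \<omega> in M. loc_unif (\<lambda>\<epsilon> x. v i \<epsilon> (x, 0) \<omega>) (\<lambda>x. u0 i x \<omega>)"
    proof eventually_elim
      case (elim \<omega>)
      have "loc_unif (\<lambda>\<epsilon> x. v i \<epsilon> (x, 0) \<omega> - v' \<epsilon> (x, 0) \<omega>) (\<lambda>x. 0)"
        using elim(2) by (rule loc_unif_restrict)
      from loc_unif_add[OF loc_unif_add[OF this elim(1)] elim(3)] show ?case by simp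
    qed
  qed
  have ev_F: "AE \<omega> in M. \<forall>i j. loc_unif (\<lambda>\<epsilon> z. ?F i j \<epsilon> z \<omega>) (\<lambda>z. f i j z \<omega>) \<and>
      continuous_on UNIV (\<lambda>z. f i j z \<omega>)"
    by (intro eventually_all_finite eventually_conj embed_loc_unif \<rho>2 C1_paths_continuous f)
  have ev_G: "AE \<omega> in M. \<forall>i. loc_unif (\<lambda>\<epsilon> z. ?G i \<epsilon> z \<omega>) (\<lambda>z. g i z \<omega>) \<and>
      continuous_on UNIV (\<lambda>z. lam i z \<omega>)"
    by (intro eventually_all_finite eventually_conj embed_loc_unif \<rho>2 C1_paths_continuous g lam)
  have ev_C1: "AE \<omega> in M. \<forall>i. (\<lambda>\<epsilon> z. v i \<epsilon> z \<omega>) \<in> E_M \<and> C_k 1 (\<lambda>z. uc i z \<omega>)"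
    using vE uc unfolding E_M_L0_iff classical_solution_def C1_paths_def
    by (intro eventually_all_finite eventually_conj) blast+
  have uc_eqn: "AE \<omega> in M. \<forall>i x t.
        partial_deriv (0, 1) (\<lambda>z. uc i z \<omega>) (x, t)
          + lam i (x, t) \<omega> * partial_deriv (1, 0) (\<lambda>z. uc i z \<omega>) (x, t)
        = (\<Sum>j\<in>UNIV. f i j (x, t) \<omega> * uc j (x, t) \<omega>) + g i (x, t) \<omega>"
    and uc_init: "AE \<omega> in M. \<forall>i x. uc i (x, 0) \<omega> = u0 i x \<omega>"
    using uc by (simp_all add: classical_solution_def)
  from ev_l ev_init ev_F ev_G ev_C1 uc_eqn uc_init cond_UB_pathwise[OF UB]
  show ?thesis
  proof eventually_elim
    case (elim \<omega>)
    \<comment> \<open>With the residual \<open>e\<close> added to the source, the representative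
      solves its system exactly for each \<epsilon>, and the limit of the source is
      unchanged.\<close>
    define e where "e i \<epsilon> z = partial_deriv (0, 1) (\<lambda>z. v i \<epsilon> z \<omega>) z
      + l i \<epsilon> z \<omega> * partial_deriv (1, 0) (\<lambda>z. v i \<epsilon> z \<omega>) z - ?R i \<epsilon> z \<omega>" for i \<epsilon> z
    show ?case
    proof
      fix i
      show "loc_unif (\<lambda>\<epsilon> z. v i \<epsilon> z \<omega>) (\<lambda>z. uc i z \<omega>)"
      proof (rule linear_transport_convergence[where l = "\<lambda>i \<epsilon> z. l i \<epsilon> z \<omega>" and lam = "\<lambda>i z. lam i z \<omega>"
            and fe = "\<lambda>i j \<epsilon> z. ?F i j \<epsilon> z \<omega>" and f = "\<lambda>i j z. f i j z \<omega>"
            and ge = "\<lambda>i \<epsilon> z. ?G i \<epsilon> z \<omega> + e i \<epsilon> z" and g = "\<lambda>i z. g i z \<omega>"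
            and v = "\<lambda>i \<epsilon> z. v i \<epsilon> z \<omega>" and u = "\<lambda>i z. uc i z \<omega>"])
        show "C_k 1 (\<lambda>z. v i \<epsilon> z \<omega>)" if "\<epsilon> \<in> {0<..1}" for i \<epsilon>
          using elim(5) that unfolding E_M_iff C_infinity_def by blast
        have "loc_unif (e i) (\<lambda>z. 0)" for i using elim(1) unfolding e_def by blast
        then show "loc_unif (\<lambda>\<epsilon> z. ?G i \<epsilon> z \<omega> + e i \<epsilon> z) (\<lambda>z. g i z \<omega>)" for i
          using loc_unif_add[of "\<lambda>\<epsilon> z. ?G i \<epsilon> z \<omega>" "\<lambda>z. g i z \<omega>" "e i" "\<lambda>z. 0"] elim(4) by simp
        show "loc_unif (\<lambda>\<epsilon> x. v i \<epsilon> (x, 0) \<omega>) (\<lambda>x. uc i (x, 0) \<omega>)" for i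
          using elim(2,7) by simp
        show "partial_deriv (0, 1) (\<lambda>z. v i \<epsilon> z \<omega>) z + l i \<epsilon> z \<omega> * partial_deriv (1, 0) (\<lambda>z. v i \<epsilon> z \<omega>) z
            = ?S i \<epsilon> z \<omega> + (?G i \<epsilon> z \<omega> + e i \<epsilon> z)" for i \<epsilon> z
          by (simp add: e_def)
        show "partial_deriv (0, 1) (\<lambda>z. uc i z \<omega>) z + lam i z \<omega> * partial_deriv (1, 0) (\<lambda>z. uc i z \<omega>) z
            = (\<Sum>j\<in>UNIV. f i j z \<omega> * uc j z \<omega>) + g i z \<omega>" for i z
          using elim(6) by (cases z) blast
        show "\<exists>c. \<forall>i x t. \<bar>t\<bar> \<le> T \<longrightarrow> \<bar>lam i (x, t) \<omega>\<bar> \<le> c" for T using elim(8) by blast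
      qed (use elim in blast)+
    qed
  qed
qed

theorem proposition5p2:
  fixes M :: "'w measure"
    and lam g uc :: "'n::finite \<Rightarrow> real \<times> real \<Rightarrow> 'w \<Rightarrow> real"
    and f :: "'n \<Rightarrow> 'n \<Rightarrow> real \<times> real \<Rightarrow> 'w \<Rightarrow> real"
    and u0 :: "'n \<Rightarrow> real \<Rightarrow> 'w \<Rightarrow> real"
    and \<rho>1 \<theta>1 :: "real \<Rightarrow> real"
    and \<rho>2 \<theta>2 :: "real \<times> real \<Rightarrow> real"
    and u :: "'n \<Rightarrow> (real \<times> real, 'w) field_family set"
  assumes "prob_space M" and "complete_measure M"
    and "mollifier \<rho>1" and "cutoff \<theta>1" and "mollifier \<rho>2" and "cutoff \<theta>2"
    and "\<And>i. random_field M (lam i)" and "\<And>i. C1_paths M (lam i)"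
    and "\<And>i j. random_field M (f i j)" and "\<And>i j. C1_paths M (f i j)"
    and "\<And>i. random_field M (g i)" and "\<And>i. C1_paths M (g i)"
    and "\<And>i. random_field M (u0 i)" and "\<And>i. C1_paths M (u0 i)"
    and "cond_AL M lam" and "cond_UB M lam"
    and "classical_solution M lam f g u0 uc"
    and "generalized_solution M
           (\<lambda>i. iota M \<rho>2 \<theta>2 (lam i)) (\<lambda>i j. iota M \<rho>2 \<theta>2 (f i j))
           (\<lambda>i. iota M \<rho>2 \<theta>2 (g i)) (\<lambda>i. iota M \<rho>1 \<theta>1 (u0 i)) u"
  shows "(\<forall>i. associated M (u i) (uc i)) \<and>
    (\<forall>v. (\<forall>i. v i \<in> u i) \<longrightarrow>
       (AE \<omega> in M. \<forall>i K. compact K \<longrightarrow>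
          uniform_limit K (\<lambda>\<epsilon> z. v i \<epsilon> z \<omega>) (\<lambda>z. uc i z \<omega>) (at_right 0)))"
proof (intro conjI allI impI)
  note conv = gen_solution_locally_uniform[OF assms(2-6,8-14,16-18)]
  fix v assume "\<forall>i. v i \<in> u i"
  then have "AE \<omega> in M. \<forall>i. loc_unif (\<lambda>\<epsilon> z. v i \<epsilon> z \<omega>) (\<lambda>z. uc i z \<omega>)" by (intro conv) simp
  then show "AE \<omega> in M. \<forall>i K. compact K \<longrightarrow>
      uniform_limit K (\<lambda>\<epsilon> z. v i \<epsilon> z \<omega>) (\<lambda>z. uc i z \<omega>) (at_right 0)"
    by (simp add: loc_unif_def)
next
  note conv = gen_solution_locally_uniform[OF assms(2-6,8-14,16-18)]
  fix i
  have uG: "u j \<in> G_L0 M" for j using assms(18) by (simp add: generalized_solution_def)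
  have "\<forall>j. \<exists>y. y \<in> u j" using G_L0_nonempty[OF uG] by blast
  from choice[OF this] obtain y where y: "\<forall>j. y j \<in> u j" ..
  show "associated M (u i) (uc i)"
    unfolding associated_def
  proof
    fix w assume w: "w \<in> u i"
    \<comment> \<open>The convergence result concerns a full vector of representatives, so
      \<open>w\<close> is completed by arbitrary members of the other classes.\<close>
    have "(y(i := w)) j \<in> u j" for j using y w by simp
    then have "AE \<omega> in M. \<forall>j. loc_unif (\<lambda>\<epsilon> z. (y(i := w)) j \<epsilon> z \<omega>) (\<lambda>z. uc j z \<omega>)" by (rule conv)
    moreover have "AE \<omega> in M. (\<lambda>\<epsilon> z. w \<epsilon> z \<omega>) \<in> E_M"
      using G_L0_E_M_L0[OF uG w] by (simp add: E_M_L0_iff)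
    moreover have "AE \<omega> in M. continuous_on UNIV (\<lambda>z. uc i z \<omega>)"
      using assms(17) by (intro C1_paths_continuous) (simp add: classical_solution_def)
    ultimately show "AE \<omega> in M. \<forall>\<phi>. test_function \<phi> \<longrightarrow>
        ((\<lambda>\<epsilon>. \<integral>x. w \<epsilon> x \<omega> * \<phi> x \<partial>lborel) \<longlongrightarrow> (\<integral>x. uc i x \<omega> * \<phi> x \<partial>lborel)) (at_right 0)"
    proof eventually_elim
      case (elim \<omega>)
      have "loc_unif (\<lambda>\<epsilon> z. w \<epsilon> z \<omega>) (\<lambda>z. uc i z \<omega>)" using elim(1)[rule_format, of i] by simp
      then show ?case
        using elim(2,3) by (auto intro!: loc_unif_imp_integral_tendsto C_infinity_continuous simp: E_M_iff)
    qed
  qed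
qed

end
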